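(* Let $\pi:\overline N\to\mathcal H$ be any tree-level q-map space, associated to a PSR manifold $\mathcal H$ of dimension $n-1\ge0$ with cubic polynomial $h$. The fiber volume density function $\delta\in C^\infty(\overline N)$ is given by $$\delta(\overline p)=\frac{\mathrm{const}}{\rho^{n+3}r^{n+1}}\left|\det\left(\frac{\partial^2h(\pi(\overline p))}{\partial t^a\partial t^b}\right)\right|^{1/2},$$ where $\mathrm{const}$ is a positive constant depending only on $n=\dim(\mathcal H)+1$.
   Context: Conventions: indices $a,b,c,\dots$ run from $1$ to $n$, indices $i,j,k,\dots$ from $0$ to $n$; repeated indices are summed. PSR manifold: let $h(t)=\frac16 k_{abc}t^at^bt^c$ ($k_{abc}\in\mathbb R$ symmetric) be a homogeneous cubic polynomial on $\mathbb R^n$. A projective special real (PSR) manifold is a hypersurface $\mathcal H\subset\{t\in\mathbb R^n\mid h(t)=1\}$ such that $g_{\mathcal H}=-\partial^2h|_{T\mathcal H\times T\mathcal H}$ is a Riemannian metric. Tree-level q-map space: put $U=\mathbb R_{>0}\cdot\mathcal H\subset\mathbb R^n$, $\overline M=\mathbb R^n+iU\subset\mathbb C^n$ with coordinates $z^a=b^a+it^a$, $z^0:=1$, $K(t)=8h(t)$, $\mathcal K=-\log K$, and $g_{\overline M}=\frac{\partial^2\mathcal K}{\partial z^a\partial\overline z^b}dz^ad\overline z^b=-\frac14\frac{\partial^2\log h}{\partial t^a\partial t^b}(db^adb^b+dt^adt^b)$. Let $\mathfrak F(X)=-h(X^1,\dots,X^n)/X^0$, $\tau_{ij}=\frac{\partial^2\mathfrak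 F}{\partial X^i\partial X^j}$ evaluated at $X=(1,z)$, $N_{ij}=-2\,\mathrm{Im}(\tau_{ij})$, $(N^{ij})=(N_{ij})^{-1}$, $W_i=d\widetilde\zeta_i-\tau_{ij}d\zeta^j$; then $K=N_{ij}z^i\overline z^j$. The tree-level q-map space is $\overline N=\overline M\times\mathbb R_{>0}\times\mathbb R^{2n+2}\times\mathbb R$ with global ("type IIA") coordinates $(z^a,\rho,\widetilde\zeta_i,\zeta^i,\sigma)$ and metric $$g_{\overline N}=g_{\overline M}+\frac{d\rho^2}{4\rho^2}-\frac1{4\rho}\Big(N^{ij}-\frac2Kz^i\overline z^j\Big)W_i\overline W_j+\frac1{64\rho^2}\big(d\sigma+\widetilde\zeta_id\zeta^i-\zeta^id\widetilde\zeta_i\big)^2 .$$ Fiber volume density: writing $t=rp$ with $r=h(t)^{1/3}>0$ and $p\in\mathcal H$ identifies $\overline N\cong\mathcal H\times\mathbb R_{>0}^2\times\mathbb R^{3n+3}$ with fiber coordinates $(r,\rho,b^a,\widetilde\zeta_i,\zeta^i,\sigma)$; $\pi:\overline N\to\mathcal H$ is the projection to $p=t/h(t)^{1/3}$. The $\mathcal H$-direction is $g_{\overline N}$-orthogonal to the fibers of $\pi$. The positive function $\delta\in C^\infty(\overline N)$ is defined by $$\det g_{\overline N}\big|_{(T_p\mathcal H)^\perp}=(\delta(\overline p)\,\mathrm{dvol}_f)^{\otimes2},\qquad p=\pi(\overline p),$$ where $\mathrm{dvol}_f$ is the product of the differentials of the fiber coordinates $(r,\rho,b^a,\widetilde\zeta_i,\zeta^i,\sigma)$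 and $(T_p\mathcal H)^\perp$ is the $g_{\overline N}$-orthogonal complement of $T_p\mathcal H\subset T_{\overline p}\overline N$ (i.e. the tangent space of the fiber of $\pi$); so $\delta$ is the density of the Riemannian volume of the fiber with respect to these coordinates. *)

theory Defs
  imports "HOL-Analysis.Analysis"
begin

section \<open>Smooth maps and embedded hypersurfaces\<close>

text \<open>Only meant for open \<open>S\<close>.\<close>

primrec Ck_on :: "nat \<Rightarrow> 'a::euclidean_space set \<Rightarrow> ('a \<Rightarrow> 'b::euclidean_space) \<Rightarrow> bool" where
  "Ck_on 0 S f \<longleftrightarrow> continuous_on S f"
| "Ck_on (Suc k) S f \<longleftrightarrow>
    (\<exists>f'. (\<forall>x\<in>S. (f has_derivative f' x) (at x)) \<and> (\<forall>v. Ck_on k S (\<lambda>x. f' x v)))"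

definition smooth_on :: "'a::euclidean_space set \<Rightarrow> ('a \<Rightarrow> 'b::euclidean_space) \<Rightarrow> bool" where
  "smooth_on S f \<longleftrightarrow> (\<forall>k. Ck_on k S f)"

text \<open>Embedded submanifolds of codimension one, by slice charts. The empty set and disconnected
  hypersurfaces are allowed.\<close>

definition smooth_hypersurface :: "(real ^ 'n::finite) set \<Rightarrow> bool" where
  "smooth_hypersurface S \<longleftrightarrow>
    (\<forall>p\<in>S. \<exists>(A :: (real ^ 'n) set) (B :: (real ^ 'n) set) \<phi> \<psi> a. open A \<and> open B \<and> p \<in> A \<and> homeomorphism A B \<phi> \<psi> \<and>
       smooth_on A \<phi> \<and> smooth_on B \<psi> \<and> \<phi> ` (A \<inter> S) = B \<inter> {y. y $ a = 0})"

text \<open>Velocities at \<open>p\<close> of smooth curves in \<open>S\<close>.\<close>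

definition tangent_space :: "(real ^ 'n) set \<Rightarrow> real ^ 'n \<Rightarrow> (real ^ 'n) set" where
  "tangent_space S p = {v. \<exists>\<epsilon>>0. \<exists>\<gamma>. smooth_on {-\<epsilon><..<\<epsilon>} \<gamma> \<and> \<gamma> ` {-\<epsilon><..<\<epsilon>} \<subseteq> S \<and> \<gamma> 0 = p \<and>
     (\<gamma> has_vector_derivative v) (at 0)}"

text \<open>Real partial derivatives for \<open>'a = real\<close>, holomorphic ones for \<open>'a = complex\<close>.\<close>

definition partial :: "'n::finite \<Rightarrow> ('a::real_normed_field ^ 'n \<Rightarrow> 'a) \<Rightarrow> 'a ^ 'n \<Rightarrow> 'a" where
  "partial i f x = deriv (\<lambda>s. f (x + axis i s)) 0"

definition hessian :: "('a::real_normed_field ^ 'n::finite \<Rightarrow> 'a) \<Rightarrow> 'a ^ 'n \<Rightarrow> 'a ^ 'n ^ 'n" where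
  "hessian f x = (\<chi> i j. partial i (partial j f) x)"


section \<open>Projective special real manifolds\<close>

definition symmetric_coeffs :: "('n \<Rightarrow> 'n \<Rightarrow> 'n \<Rightarrow> real) \<Rightarrow> bool" where
  "symmetric_coeffs k \<longleftrightarrow> (\<forall>a b c. k a b c = k b a c \<and> k a b c = k a c b)"

text \<open>Polymorphic, since the prepotential below needs the cubic at complex arguments.\<close>

definition cubic :: "('n::finite \<Rightarrow> 'n \<Rightarrow> 'n \<Rightarrow> real) \<Rightarrow> 'a::real_normed_field ^ 'n \<Rightarrow> 'a" where
  "cubic k t = (\<Sum>a\<in>UNIV. \<Sum>b\<in>UNIV. \<Sum>c\<in>UNIV. of_real (k a b c) * t $ a * t $ b * t $ c) / 6"

definition psr_manifold :: "('n::finite \<Rightarrow> 'n \<Rightarrow> 'n \<Rightarrow> real) \<Rightarrow> (real ^ 'n) set \<Rightarrow> bool" where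
  "psr_manifold k H \<longleftrightarrow> symmetric_coeffs k \<and> smooth_hypersurface H \<and> H \<subseteq> {t. cubic k t = 1} \<and>
    (\<forall>p\<in>H. \<forall>v\<in>tangent_space H p. v \<noteq> 0 \<longrightarrow>
       0 < - (\<Sum>a\<in>UNIV. \<Sum>b\<in>UNIV. hessian (cubic k) p $ a $ b * v $ a * v $ b))"


section \<open>The tree-level q-map space\<close>

text \<open>A point is \<open>(z, \<rho>, \<zeta>t, \<zeta>, \<sigma>)\<close>, where \<open>\<zeta>t\<close> is the tuple of the coordinates \<open>\<zeta>\<close>-tilde.
  The index set from \<open>0\<close> to \<open>n\<close> is \<open>'n option\<close>, with \<open>None\<close> for \<open>0\<close>. The space is open in the
  vector space \<open>'n qpoint\<close>, which therefore also serves as its tangent space at each point.\<close>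

type_synonym 'n qpoint =
  "(complex ^ 'n) \<times> real \<times> (real ^ ('n option)) \<times> (real ^ ('n option)) \<times> real"

definition re_part :: "complex ^ 'n \<Rightarrow> real ^ 'n" where
  "re_part z = (\<chi> a. Re (z $ a))"

definition im_part :: "complex ^ 'n \<Rightarrow> real ^ 'n" where
  "im_part z = (\<chi> a. Im (z $ a))"

definition qmap_space :: "(real ^ 'n) set \<Rightarrow> 'n::finite qpoint set" where
  "qmap_space H = {(z, \<rho>, \<zeta>t, \<zeta>, \<sigma>). im_part z \<in> {s *\<^sub>R p | s p. 0 < s \<and> p \<in> H} \<and> 0 < \<rho>}"

definition extend :: "complex ^ 'n \<Rightarrow> complex ^ ('n option)" where
  "extend z = (\<chi> i. case i of None \<Rightarrow> 1 | Some a \<Rightarrow> z $ a)"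

definition prepotential ::
    "('n::finite \<Rightarrow> 'n \<Rightarrow> 'n \<Rightarrow> real) \<Rightarrow> complex ^ ('n option) \<Rightarrow> complex" where
  "prepotential k X = - cubic k (\<chi> a. X $ Some a) / X $ None"

definition tau_mat :: "('n::finite \<Rightarrow> 'n \<Rightarrow> 'n \<Rightarrow> real) \<Rightarrow> complex ^ 'n
    \<Rightarrow> complex ^ ('n option) ^ ('n option)" where
  "tau_mat k z = hessian (prepotential k) (extend z)"

definition N_mat :: "('n::finite \<Rightarrow> 'n \<Rightarrow> 'n \<Rightarrow> real) \<Rightarrow> complex ^ 'n
    \<Rightarrow> real ^ ('n option) ^ ('n option)" where
  "N_mat k z = (\<chi> i j. -2 * Im (tau_mat k z $ i $ j))"

definition W_form :: "('n::finite \<Rightarrow> 'n \<Rightarrow> 'n \<Rightarrow> real) \<Rightarrow> complex ^ 'n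
    \<Rightarrow> 'n option \<Rightarrow> 'n qpoint \<Rightarrow> complex" where
  "W_form k z i = (\<lambda>(dz, d\<rho>, d\<zeta>t, d\<zeta>, d\<sigma>).
     of_real (d\<zeta>t $ i) - (\<Sum>j\<in>UNIV. tau_mat k z $ i $ j * of_real (d\<zeta> $ j)))"

definition base_metric :: "('n::finite \<Rightarrow> 'n \<Rightarrow> 'n \<Rightarrow> real) \<Rightarrow> complex ^ 'n
    \<Rightarrow> complex ^ 'n \<Rightarrow> complex ^ 'n \<Rightarrow> real" where
  "base_metric k z v w = - 1 / 4 * (\<Sum>a\<in>UNIV. \<Sum>b\<in>UNIV.
     hessian (\<lambda>t. ln (cubic k t)) (im_part z) $ a $ b *
       (re_part v $ a * re_part w $ b + im_part v $ a * im_part w $ b))"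

text \<open>Products of one-forms are symmetric products. As the coefficients of \<open>W\<^sub>i\<close> times the conjugate
  of \<open>W\<^sub>j\<close> form a Hermitian matrix, this amounts to taking the real part in the third summand.\<close>

definition qmap_metric :: "('n::finite \<Rightarrow> 'n \<Rightarrow> 'n \<Rightarrow> real) \<Rightarrow> 'n qpoint
    \<Rightarrow> 'n qpoint \<Rightarrow> 'n qpoint \<Rightarrow> real" where
  "qmap_metric k = (\<lambda>(z, \<rho>, \<zeta>t, \<zeta>, \<sigma>) v w.
     let K = 8 * cubic k (im_part z);
         d\<rho> = (\<lambda>(dz, d\<rho>, d\<zeta>t, d\<zeta>, d\<sigma>). d\<rho>);
         \<theta> = (\<lambda>(dz, d\<rho>, d\<zeta>t, d\<zeta>, d\<sigma>).
                d\<sigma> + (\<Sum>i\<in>UNIV. \<zeta>t $ i * d\<zeta> $ i - \<zeta> $ i * d\<zeta>t $ i))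
     in base_metric k z (fst v) (fst w)
        + d\<rho> v * d\<rho> w / (4 * \<rho>\<^sup>2)
        - 1 / (4 * \<rho>) * Re (\<Sum>i\<in>UNIV. \<Sum>j\<in>UNIV.
            (of_real (matrix_inv (N_mat k z) $ i $ j)
              - of_real (2 / K) * extend z $ i * cnj (extend z $ j))
            * W_form k z i v * cnj (W_form k z j w))
        + \<theta> v * \<theta> w / (64 * \<rho>\<^sup>2))"


section \<open>The fiber volume density\<close>

definition radius :: "('n::finite \<Rightarrow> 'n \<Rightarrow> 'n \<Rightarrow> real) \<Rightarrow> 'n qpoint \<Rightarrow> real" where
  "radius k = (\<lambda>(z, _). root 3 (cubic k (im_part z)))"

definition psr_proj :: "('n::finite \<Rightarrow> 'n \<Rightarrow> 'n \<Rightarrow> real) \<Rightarrow> 'n qpoint \<Rightarrow> real ^ 'n" where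
  "psr_proj k x = im_part (fst x) /\<^sub>R radius k x"

text \<open>The tangent space of \<open>H\<close> at the projection \<open>p\<close> of \<open>x\<close>, inside the tangent space at \<open>x\<close>: with the
  fiber coordinates held fixed, moving \<open>p\<close> with velocity \<open>v\<close> moves \<open>t = r p\<close> with velocity \<open>r v\<close>.\<close>

definition psr_directions :: "('n::finite \<Rightarrow> 'n \<Rightarrow> 'n \<Rightarrow> real) \<Rightarrow> (real ^ 'n) set \<Rightarrow> 'n qpoint
    \<Rightarrow> 'n qpoint set" where
  "psr_directions k H x =
     {(\<chi> a. Complex 0 (radius k x * v $ a), 0, 0, 0, 0) | v. v \<in> tangent_space H (psr_proj k x)}"

definition fiber_directions :: "('n::finite \<Rightarrow> 'n \<Rightarrow> 'n \<Rightarrow> real) \<Rightarrow> (real ^ 'n) set \<Rightarrow> 'n qpoint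
    \<Rightarrow> 'n qpoint set" where
  "fiber_directions k H x = {w. \<forall>v\<in>psr_directions k H x. qmap_metric k x v w = 0}"

datatype 'n fiber_index =
  R_idx | Rho_idx | B_idx 'n | Zetat_idx "'n option" | Zeta_idx "'n option" | Sigma_idx

lemma UNIV_fiber_index:
  "(UNIV :: 'n fiber_index set) =
     {R_idx, Rho_idx, Sigma_idx} \<union> range B_idx \<union> range Zetat_idx \<union> range Zeta_idx"
proof -
  have "i \<in> {R_idx, Rho_idx, Sigma_idx} \<union> range B_idx \<union> range Zetat_idx \<union> range Zeta_idx"
    for i :: "'n fiber_index"
    by (cases i) auto
  then show ?thesis by blast
qed

instance fiber_index :: (finite) finite
  by standard (simp add: UNIV_fiber_index)

definition fiber_coord :: "('n::finite \<Rightarrow> 'n \<Rightarrow> 'n \<Rightarrow> real) \<Rightarrow> 'n fiber_index \<Rightarrow> 'n qpoint \<Rightarrow> real"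
  where
  "fiber_coord k i x = (case x of (z, \<rho>, \<zeta>t, \<zeta>, \<sigma>) \<Rightarrow>
     (case i of R_idx \<Rightarrow> radius k x | Rho_idx \<Rightarrow> \<rho> | B_idx a \<Rightarrow> re_part z $ a
      | Zetat_idx l \<Rightarrow> \<zeta>t $ l | Zeta_idx l \<Rightarrow> \<zeta> $ l | Sigma_idx \<Rightarrow> \<sigma>))"

text \<open>The wedge product of the differentials of the fiber coordinates, evaluated at \<open>e\<close>. The order of
  the coordinates only affects the sign, which is squared away below.\<close>

definition dvol_fiber :: "('n::finite \<Rightarrow> 'n \<Rightarrow> 'n \<Rightarrow> real) \<Rightarrow> 'n qpoint
    \<Rightarrow> ('n fiber_index \<Rightarrow> 'n qpoint) \<Rightarrow> real" where
  "dvol_fiber k x e = det (\<chi> i j. frechet_derivative (fiber_coord k i) (at x) (e j))"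

text \<open>The determinant of the restricted metric is the square of \<open>d * dvol_fiber\<close>, both sides being
  evaluated on tuples of vectors tangent to the fiber.\<close>

definition fiber_density :: "('n::finite \<Rightarrow> 'n \<Rightarrow> 'n \<Rightarrow> real) \<Rightarrow> (real ^ 'n) set \<Rightarrow> 'n qpoint \<Rightarrow> real"
  where
  "fiber_density k H x = (THE d. 0 < d \<and>
     (\<forall>e :: 'n fiber_index \<Rightarrow> 'n qpoint. range e \<subseteq> fiber_directions k H x \<longrightarrow>
        det (\<chi> i j. qmap_metric k x (e i) (e j)) = (d * dvol_fiber k x e)\<^sup>2))"

end

theory Submission
  imports Defs
begin

text \<open>
  On the tangent space of the fiber, \<open>dt\<close> equals \<open>dr\<close> times \<open>p\<close>. In the coframe
  \<open>dr\<close>, \<open>d\<rho>\<close>, \<open>db\<close>, \<open>Re W\<close>, \<open>Im W\<close>, \<open>d\<sigma> + \<dots>\<close> the metric is block diagonal, and the transition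
  from the coordinate differentials is block triangular with determinant \<open>det (N / 2)\<close>, because
  \<open>Im W = N d\<zeta> / 2\<close>. In the \<open>W\<close>-block, the real form of \<open>N\<^sup>-\<^sup>1 - 2 z z\<^sup>* / K\<close>, the two real rank one
  corrections each contribute a factor \<open>1 - 2 = -1\<close>, as \<open>z\<^sup>* N z = K\<close>; hence all determinants of \<open>N\<close>
  cancel. The \<open>db\<close>-block is \<open>-1/4\<close> times the Hessian of \<open>ln h\<close>, which is a rank one correction of
  the Hessian of \<open>h\<close> that multiplies the determinant by \<open>1 - 6/4 = -1/2\<close>, by Euler's identity.
\<close>

section \<open>Determinants\<close>

text \<open>The Leibniz sum over the permutations that move only points of \<open>S\<close>.
  Diagonal blocks are thus determinants over subsets of one index type and need no index types of
  their own.\<close>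

definition det_on :: "'i set \<Rightarrow> ('i \<Rightarrow> 'i \<Rightarrow> 'a::comm_ring_1) \<Rightarrow> 'a" where
  "det_on S A = (\<Sum>p | p permutes S. of_int (sign p) * (\<Prod>i\<in>S. A i (p i)))"

lemma det_eq_det_on: "det A = det_on UNIV (\<lambda>i j. A $ i $ j)"
  by (simp add: det_def det_on_def)

lemma det_on_singleton [simp]: "det_on {x} A = A x x"
  by (simp add: det_on_def)

text \<open>A permutation of the union that does not preserve \<open>T\<close> sends some
  \<open>i\<close> in \<open>T\<close> into \<open>S\<close> and picks a zero entry. The others
  factor uniquely as a permutation of \<open>S\<close> composed with one of \<open>T\<close>, and
  signs and products split accordingly.\<close>

lemma det_on_Un:
  assumes fin: "finite S" "finite T" and disj: "S \<inter> T = {}"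
    and zero: "\<And>i j. i \<in> T \<Longrightarrow> j \<in> S \<Longrightarrow> A i j = 0"
  shows "det_on (S \<union> T) A = det_on S A * det_on T A"
proof -
  let ?f = "\<lambda>p. of_int (sign p) * (\<Prod>i\<in>S \<union> T. A i (p i))"
  let ?PS = "{p. p permutes S}" and ?PT = "{q. q permutes T}"
  have not_block: "?f p = 0" if p: "p permutes S \<union> T" and np: "p \<notin> (\<lambda>(p, q). p \<circ> q) ` (?PS \<times> ?PT)" for p
  proof -
    \<comment> \<open>Otherwise \<open>p\<close> maps the finite set \<open>T\<close> bijectively
      onto itself. Its restriction \<open>q\<close> to \<open>T\<close> permutes \<open>T\<close>
      and \<open>p \<circ> inv q\<close> permutes \<open>S\<close>, a factorization that
      \<open>np\<close> excludes.\<close>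
    have "\<exists>i\<in>T. p i \<in> S"
    proof (rule ccontr)
      assume "\<not> ?thesis"
      then have "p ` T \<subseteq> T" using p permutes_in_image[OF p] by blast
      then have pT: "bij_betw p T T"
        using fin permutes_inj_on[OF p] by (simp add: bij_betw_def endo_inj_surj)
      define q where "q = restrict_id p T"
      have q: "q permutes T" unfolding q_def using pT by (rule permutes_restrict_id)
      have "p \<circ> inv q permutes S \<union> T"
        by (intro permutes_compose p permutes_subset[OF permutes_inv[OF q]]) auto
      moreover have "(p \<circ> inv q) x = x" if "x \<in> S \<union> T - S" for x
      proof -
        have "inv q x \<in> T" using that permutes_in_image[OF permutes_inv[OF q]] by blast
        then have "p (inv q x) = q (inv q x)" by (simp add: q_def)
        then show ?thesis by (simp add: permutes_inverses[OF q])
      qed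
      ultimately have "p \<circ> inv q permutes S" by (rule permutes_superset)
      moreover have "p = (p \<circ> inv q) \<circ> q" by (simp add: o_assoc[symmetric] permutes_inv_o[OF q])
      ultimately show False using np q by (metis (mono_tags, lifting) SigmaI case_prod_conv image_eqI mem_Collect_eq)
    qed
    then obtain i where i: "i \<in> T" "p i \<in> S" by blast
    then have "A i (p i) = 0" by (rule zero)
    then have "(\<Prod>i\<in>S \<union> T. A i (p i)) = 0" using fin i by (intro prod_zero) auto
    then show ?thesis by simp
  qed
  have inj: "inj_on (\<lambda>(p, q). p \<circ> q) (?PS \<times> ?PT)"
  proof (rule inj_onI, clarsimp)
    fix p q p' q' assume pq: "p permutes S" "q permutes T" "p' permutes S" "q' permutes T" and eq: "p \<circ> q = p' \<circ> q'"
    have "q x = q' x" for x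
    proof (cases "x \<in> T")
      case True
      then have "q x \<in> T" "q' x \<in> T" using pq permutes_in_image by metis+
      then have "p (q x) = q x" "p' (q' x) = q' x" using pq disj by (auto intro!: permutes_not_in)
      then show ?thesis using fun_cong[OF eq, of x] by simp
    qed (use pq in \<open>auto simp: permutes_not_in\<close>)
    then have "q = q'" by auto
    moreover have "p = p'"
      using eq \<open>q = q'\<close> permutes_surj[OF pq(4)] by (metis surj_fun_eq)
    ultimately show "p = p' \<and> q = q'" by simp
  qed
  have val: "?f (p \<circ> q) = (of_int (sign p) * (\<Prod>i\<in>S. A i (p i))) * (of_int (sign q) * (\<Prod>i\<in>T. A i (q i)))"
    if pq: "p permutes S" "q permutes T" for p q
  proof -
    have "(\<Prod>i\<in>S \<union> T. A i ((p \<circ> q) i)) = (\<Prod>i\<in>S. A i ((p \<circ> q) i)) * (\<Prod>i\<in>T. A i ((p \<circ> q) i))"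
      using fin disj by (rule prod.union_disjoint)
    also have "(\<Prod>i\<in>S. A i ((p \<circ> q) i)) = (\<Prod>i\<in>S. A i (p i))"
      using pq disj by (intro prod.cong) (auto simp: permutes_not_in disjoint_iff)
    also have "(\<Prod>i\<in>T. A i ((p \<circ> q) i)) = (\<Prod>i\<in>T. A i (q i))"
    proof (rule prod.cong)
      fix i assume "i \<in> T"
      then have "q i \<notin> S" using pq permutes_in_image disj by (metis disjoint_iff)
      then show "A i ((p \<circ> q) i) = A i (q i)" using pq by (simp add: permutes_not_in)
    qed simp
    moreover have "sign (p \<circ> q) = sign p * sign q"
      using pq fin by (intro sign_compose) (auto simp: permutation_permutes)
    ultimately show ?thesis by simp
  qed
  have "det_on (S \<union> T) A = (\<Sum>p\<in>(\<lambda>(p, q). p \<circ> q) ` (?PS \<times> ?PT). ?f p)"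
    unfolding det_on_def
  proof (rule sum.mono_neutral_right)
    show "finite {p. p permutes S \<union> T}" using fin by (simp add: finite_permutations)
    show "(\<lambda>(p, q). p \<circ> q) ` (?PS \<times> ?PT) \<subseteq> {p. p permutes S \<union> T}"
      by (auto intro!: permutes_compose intro: permutes_subset)
  qed (use not_block in auto)
  also have "\<dots> = (\<Sum>(p, q)\<in>?PS \<times> ?PT. ?f (p \<circ> q))"
    by (subst sum.reindex[OF inj]) (simp add: case_prod_unfold)
  also have "\<dots> = (\<Sum>(p, q)\<in>?PS \<times> ?PT. (of_int (sign p) * (\<Prod>i\<in>S. A i (p i))) * (of_int (sign q) * (\<Prod>i\<in>T. A i (q i))))"
    by (rule sum.cong) (auto simp: val simp del: o_apply)
  also have "\<dots> = det_on S A * det_on T A"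
    by (simp add: det_on_def sum_product sum.cartesian_product)
  finally show ?thesis .
qed

text \<open>Transport along \<open>f\<close> is a sign-preserving bijection between the permutations
  of \<open>S\<close> and those of its image.\<close>

lemma det_on_image:
  assumes inj: "inj_on f S" and fin: "finite S"
  shows "det_on (f ` S) A = det_on S (\<lambda>i j. A (f i) (f j))"
proof -
  have bij: "bij_betw f S (f ` S)" using inj by (simp add: bij_betw_def)
  have mp: "map_permutation S f p = (\<lambda>x. if x \<in> f ` S then f (p (inv_into S f x)) else x)" for p
    by (auto simp: map_permutation_def restrict_id_def)
  have b: "bij_betw (map_permutation S f) {p. p permutes S} {p. p permutes f ` S}"
    using bij_betw_permutations[OF bij] by (simp add: mp[abs_def])
  show ?thesis
    unfolding det_on_def
    by (subst sum.reindex_bij_betw[OF b, symmetric])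
       (auto intro!: sum.cong simp: prod.reindex[OF inj] sign_map_permutation inj fin map_permutation_apply)
qed

lemma det_on_range:
  fixes f :: "'i::finite \<Rightarrow> 'j"
  shows "inj f \<Longrightarrow> det_on (range f) A = det (\<chi> i j. A (f i) (f j))"
  by (simp add: det_on_image det_eq_det_on)

section \<open>Bordered matrices and rank one updates of determinants\<close>

lemma UNIV_option_split: "UNIV = {None} \<union> range Some"
  using UNIV_option_conv by auto

lemma det_option_lower:
  fixes A :: "'a::comm_ring_1 ^ 'n::finite option ^ 'n option"
  assumes "\<And>b. A $ None $ Some b = 0"
  shows "det A = A $ None $ None * det (\<chi> a b. A $ Some a $ Some b)"
proof -
  have "det A = det_on (range Some \<union> {None}) (\<lambda>i j. A $ i $ j)"
    unfolding det_eq_det_on by (simp add: UNIV_option_split Un_commute)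
  also have "\<dots> = det_on (range Some) (\<lambda>i j. A $ i $ j) * det_on {None} (\<lambda>i j. A $ i $ j)"
    by (rule det_on_Un) (auto simp: assms)
  finally show ?thesis by (simp add: det_on_range mult.commute)
qed

lemma det_option_upper:
  fixes A :: "'a::comm_ring_1 ^ 'n::finite option ^ 'n option"
  assumes "\<And>a. A $ Some a $ None = 0"
  shows "det A = A $ None $ None * det (\<chi> a b. A $ Some a $ Some b)"
proof -
  have "det A = det (Finite_Cartesian_Product.transpose A)" by simp
  also have "\<dots> = A $ None $ None * det (\<chi> a b. A $ Some b $ Some a)"
    by (subst det_option_lower) (simp_all add: Finite_Cartesian_Product.transpose_def assms)
  also have "(\<chi> a b. A $ Some b $ Some a) = Finite_Cartesian_Product.transpose (\<chi> a b. A $ Some a $ Some b)"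
    by (simp add: Finite_Cartesian_Product.transpose_def)
  finally show ?thesis by simp
qed

lemma sum_UNIV_option:
  fixes f :: "'n::finite option \<Rightarrow> 'a::comm_monoid_add"
  shows "(\<Sum>i\<in>UNIV. f i) = f None + (\<Sum>a\<in>UNIV. f (Some a))"
  by (simp add: UNIV_option_conv sum.reindex)

text \<open>The bordered matrix \<open>M\<close> is brought to block triangular form by the unimodular \<open>L\<close>, once from the
  left and once from the right.\<close>

lemma det_rank_one_update:
  fixes u v :: "'a::comm_ring_1 ^ 'n::finite"
  shows "det (\<chi> i j. (if i = j then 1 else 0) + u $ i * v $ j) = 1 + (\<Sum>i\<in>UNIV. u $ i * v $ i)"
    (is "det ?I = _")
proof -
  define M :: "'a ^ 'n option ^ 'n option" where
    "M = (\<chi> i j. case (i, j) of (None, None) \<Rightarrow> 1 | (None, Some b) \<Rightarrow> - v $ b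
       | (Some a, None) \<Rightarrow> u $ a | (Some a, Some b) \<Rightarrow> if a = b then 1 else 0)"
  define L :: "'a ^ 'n option ^ 'n option" where
    "L = (\<chi> i j. case (i, j) of (None, None) \<Rightarrow> 1 | (None, Some b) \<Rightarrow> 0
       | (Some a, None) \<Rightarrow> - u $ a | (Some a, Some b) \<Rightarrow> if a = b then 1 else 0)"
  have I1: "(\<chi> a b. if a = b then 1 else 0) = (mat 1 :: 'a ^ 'n ^ 'n)" by (simp add: mat_def)
  have L: "det L = 1" by (subst det_option_lower) (simp_all add: L_def I1)
  have "det M = det (L ** M)" by (simp add: det_mul L)
  also have "\<dots> = det ?I"
    by (subst det_option_upper)
       (auto simp: L_def M_def matrix_matrix_mult_def sum_UNIV_option if_distrib[of "\<lambda>x. x * _"] cong: if_cong intro!: arg_cong[where f = det])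
  finally have 1: "det M = det ?I" .
  have "det M = det (M ** L)" by (simp add: det_mul L)
  also have "\<dots> = 1 + (\<Sum>i\<in>UNIV. u $ i * v $ i)"
    by (subst det_option_upper)
       (auto simp: L_def M_def matrix_matrix_mult_def sum_UNIV_option if_distrib[of "\<lambda>x. _ * x"] I1 mult.commute cong: if_cong)
  finally show ?thesis using 1 by simp
qed

text \<open>As \<open>D\<close> maps \<open>u\<close> to \<open>a\<close>, the updated matrix is
  \<open>D\<close> times a rank one update of the identity. A preimage \<open>u\<close> of
  \<open>a\<close> takes the place of the inverse of \<open>D\<close>.\<close>

lemma det_add_rank_one:
  fixes D :: "real ^ 'n::finite ^ 'n"
  assumes a: "D *v u = a"
  shows "det (\<chi> i j. D $ i $ j + a $ i * v $ j) = det D * (1 + u \<bullet> v)"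
proof -
  have "(\<chi> i j. D $ i $ j + a $ i * v $ j) = D ** (\<chi> i j. (if i = j then 1 else 0) + u $ i * v $ j)"
    by (simp add: a[symmetric] vec_eq_iff matrix_matrix_mult_def matrix_vector_mult_def
        distrib_left sum.distrib sum_distrib_right mult.assoc if_distrib[of "\<lambda>x. _ * x"] cong: if_cong)
  then show ?thesis by (simp add: det_mul det_rank_one_update inner_vec_def)
qed

text \<open>The determinant cannot vanish on the segment from the identity to \<open>Q\<close>.\<close>

lemma det_pos_if_pos_definite:
  fixes Q :: "real ^ 'n::finite ^ 'n"
  assumes Q: "\<And>v. v \<noteq> 0 \<Longrightarrow> 0 < v \<bullet> (Q *v v)"
  shows "0 < det Q"
proof (rule ccontr)
  assume neg: "\<not> 0 < det Q"
  define P where "P s = (1 - s) *\<^sub>R mat 1 + s *\<^sub>R Q" for s :: real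
  have pos: "0 < v \<bullet> (P s *v v)" if "0 \<le> s" "s \<le> 1" "v \<noteq> 0" for s v
  proof -
    have "v \<bullet> (P s *v v) = (1 - s) * (v \<bullet> v) + s * (v \<bullet> (Q *v v))"
      by (simp add: P_def matrix_vector_mult_add_rdistrib inner_add_right flip: scaleR_matrix_vector_assoc)
    moreover have "0 < v \<bullet> v" "0 < v \<bullet> (Q *v v)" using that Q by auto
    ultimately show ?thesis using that
      by (cases "s = 0") (auto intro!: add_nonneg_pos)
  qed
  have "continuous_on {0..1} (\<lambda>s. det (P s))"
    unfolding det_def P_def by (auto intro!: continuous_intros)
  moreover have "det (P 0) = 1" "det (P 1) = det Q" by (simp_all add: P_def)
  ultimately obtain s where s: "0 \<le> s" "s \<le> 1" "det (P s) = 0"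
    using IVT2'[of "\<lambda>s. det (P s)" 1 0 0] neg by auto
  then have "\<not> inj ((*v) (P s))" by (simp add: det_nz_iff_inj[symmetric])
  then obtain v where "v \<noteq> 0" "P s *v v = 0"
    by (metis (no_types, lifting) injI matrix_vector_mult_diff_distrib right_minus_eq)
  then show False using pos[of s v] s by simp
qed

lemma det_scale_entries: "det (\<chi> i j. c * A $ i $ j) = c ^ CARD('n) * det A"
  for A :: "'a::comm_ring_1 ^ 'n::finite ^ 'n"
  using det_rows_mul[of "\<lambda>_. c" "\<lambda>i. A $ i"] by (simp add: vector_scalar_mult_def)

text \<open>Two successive rank one updates. Because \<open>a\<close> is orthogonal to
  \<open>b'\<close>, the first update does not change the image of \<open>b'\<close>, so
  \<open>b'\<close> still serves as preimage of \<open>b\<close> and the two factors do not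
  interact.\<close>

lemma det_add_two_rank_one:
  fixes D :: "real ^ 'n::finite ^ 'n"
  assumes a: "D *v a' = a" and b: "D *v b' = b" and ab: "a \<bullet> b' = 0"
  shows "det (\<chi> i j. D $ i $ j + c * (a $ i * a $ j + b $ i * b $ j))
    = det D * (1 + c * (a \<bullet> a')) * (1 + c * (b \<bullet> b'))"
proof -
  define D1 where "D1 = (\<chi> i j. D $ i $ j + (c *\<^sub>R a) $ i * a $ j)"
  have "D1 *v b' = D *v b' + (a \<bullet> b') *\<^sub>R (c *\<^sub>R a)"
    by (simp add: D1_def vec_eq_iff matrix_vector_mult_def inner_vec_def sum.distrib sum_distrib_left sum_distrib_right algebra_simps)
  then have "D1 *v (c *\<^sub>R b') = c *\<^sub>R b"
    by (simp add: ab b matrix_vector_mult_scaleR)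
  from det_add_rank_one[OF this, of b]
  have "det (\<chi> i j. D1 $ i $ j + (c *\<^sub>R b) $ i * b $ j) = det D1 * (1 + c * (b \<bullet> b'))"
    by (simp add: inner_commute)
  moreover have "det D1 = det D * (1 + c * (a \<bullet> a'))"
    unfolding D1_def
    by (subst det_add_rank_one[where u = "c *\<^sub>R a'"]) (simp_all add: a matrix_vector_mult_scaleR inner_commute)
  moreover have "(\<chi> i j. D1 $ i $ j + (c *\<^sub>R b) $ i * b $ j) = (\<chi> i j. D $ i $ j + c * (a $ i * a $ j + b $ i * b $ j))"
    by (simp add: D1_def algebra_simps)
  ultimately show ?thesis by simp
qed

section \<open>Tangent spaces of level sets\<close>

text \<open>By the chain rule the derivative of the composition is again a composition with the same
  affine line, now of a directional derivative of \<open>f\<close>. Hence the induction over all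
  \<open>f\<close>.\<close>

lemma Ck_on_affine:
  fixes f :: "'a::euclidean_space \<Rightarrow> 'b::euclidean_space" and S :: "real set"
  assumes "Ck_on k B f" "\<And>s. s \<in> S \<Longrightarrow> q + s *\<^sub>R w \<in> B"
  shows "Ck_on k S (\<lambda>s. f (q + s *\<^sub>R w))"
  using assms(1)
proof (induction k arbitrary: f)
  case 0
  then show ?case using assms(2)
    by (auto intro!: continuous_on_compose2[of B f] continuous_intros)
next
  case (Suc k)
  then obtain f' where f': "\<And>x. x \<in> B \<Longrightarrow> (f has_derivative f' x) (at x)"
    and Ck: "\<And>v. Ck_on k B (\<lambda>x. f' x v)" by auto
  have "((\<lambda>s. f (q + s *\<^sub>R w)) has_derivative (\<lambda>u. f' (q + s *\<^sub>R w) (u *\<^sub>R w))) (at s)" if "s \<in> S" for s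
    using assms(2)[OF that]
    by (auto intro!: has_derivative_compose[of "\<lambda>s. q + s *\<^sub>R w" "\<lambda>u. u *\<^sub>R w", OF _ f'] derivative_eq_intros)
  then show ?case using Suc.IH[OF Ck]
    by (simp only: Ck_on.simps) (rule exI[of _ "\<lambda>s u. f' (q + s *\<^sub>R w) (u *\<^sub>R w)"], blast)
qed

text \<open>The velocities of the images of straight lines in a slice chart.\<close>

lemma hypersurface_tangent_space_superset:
  fixes H :: "(real ^ 'n::finite) set"
  assumes H: "smooth_hypersurface H" and p: "p \<in> H"
  obtains V where "subspace V" "dim V = CARD('n) - 1" "V \<subseteq> tangent_space H p"
proof -
  obtain A B :: "(real ^ 'n) set" and \<phi> \<psi> a where
    op: "open A" "open B" and pA: "p \<in> A" and hom: "homeomorphism A B \<phi> \<psi>"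
    and sm: "smooth_on A \<phi>" "smooth_on B \<psi>" and sl: "\<phi> ` (A \<inter> H) = B \<inter> {y. y $ a = 0}"
    using H p unfolding smooth_hypersurface_def by metis
  have "Ck_on (Suc 0) A \<phi>" "Ck_on (Suc 0) B \<psi>" using sm by (auto simp only: smooth_on_def)
  then have "\<exists>\<phi>'. \<forall>x\<in>A. (\<phi> has_derivative \<phi>' x) (at x)" "\<exists>\<psi>'. \<forall>y\<in>B. (\<psi> has_derivative \<psi>' y) (at y)"
    unfolding Ck_on.simps by blast+
  then obtain \<phi>' \<psi>' where \<phi>': "\<And>x. x \<in> A \<Longrightarrow> (\<phi> has_derivative \<phi>' x) (at x)"
    and \<psi>': "\<And>y. y \<in> B \<Longrightarrow> (\<psi> has_derivative \<psi>' y) (at y)"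
    by blast
  define q where "q = \<phi> p"
  have q: "q \<in> B" "q $ a = 0" "\<psi> q = p"
    using sl pA p hom unfolding q_def homeomorphism_def by blast+
  have lin: "linear (\<psi>' q)" using \<psi>'[OF q(1)] by (simp add: has_derivative_linear)
  \<comment> \<open>Differentiating \<open>\<phi> \<circ> \<psi> = id\<close> at \<open>q\<close>
    exhibits a left inverse of \<open>\<psi>' q\<close>, so the image of the slice directions keeps
    its dimension.\<close>
  have "((\<lambda>y. \<phi> (\<psi> y)) has_derivative (\<lambda>v. \<phi>' p (\<psi>' q v))) (at q)"
    using has_derivative_compose[OF \<psi>'[OF q(1)], of \<phi> "\<phi>' p"] \<phi>'[OF pA] by (simp add: q)
  then have "((\<lambda>y. y) has_derivative (\<lambda>v. \<phi>' p (\<psi>' q v))) (at q)"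
    by (rule has_derivative_transform_within_open[OF _ op(2) q(1)])
       (use hom in \<open>simp add: homeomorphism_def\<close>)
  then have "(\<lambda>v. \<phi>' p (\<psi>' q v)) = (\<lambda>v. v)" by (rule has_derivative_unique) simp
  then have inj: "inj (\<psi>' q)" by (metis injI)
  define W where "W = {w :: real ^ 'n. axis a 1 \<bullet> w = 0}"
  have W: "subspace W" unfolding W_def by (rule subspace_hyperplane)
  have "dim W = CARD('n) - 1" unfolding W_def by (subst dim_hyperplane) (auto simp: axis_eq_0_iff)
  then have "dim (\<psi>' q ` W) = CARD('n) - 1"
    by (subst dim_image_eq[OF lin]) (auto intro: inj_on_subset[OF inj])
  moreover have "\<psi>' q ` W \<subseteq> tangent_space H p"
  proof (rule image_subsetI)
    fix w assume "w \<in> W"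
    then have w: "w $ a = 0" by (simp add: W_def inner_axis')
    have "open ((\<lambda>s. q + s *\<^sub>R w) -` B)"
      using op(2) by (intro open_vimage continuous_intros)
    then obtain e where e: "e > 0" "ball 0 e \<subseteq> (\<lambda>s. q + s *\<^sub>R w) -` B"
      using q(1) openE[of "(\<lambda>s. q + s *\<^sub>R w) -` B" 0] by auto
    have inB: "q + s *\<^sub>R w \<in> B" if "s \<in> {-e<..<e}" for s
      using e(2) that by (auto simp: subset_iff)
    let ?\<gamma> = "\<lambda>s. \<psi> (q + s *\<^sub>R w)"
    have "smooth_on {-e<..<e} ?\<gamma>"
      using sm(2) inB by (auto simp: smooth_on_def intro!: Ck_on_affine)
    moreover have "?\<gamma> s \<in> H" if "s \<in> {-e<..<e}" for s
    proof -
      have "q + s *\<^sub>R w \<in> \<phi> ` (A \<inter> H)" using inB[OF that] w q(2) sl by auto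
      then show ?thesis using hom unfolding homeomorphism_def by force
    qed
    moreover have "(?\<gamma> has_vector_derivative \<psi>' q w) (at 0)"
      unfolding has_vector_derivative_def
      using lin \<psi>'[OF q(1)]
      by (auto intro!: derivative_eq_intros has_derivative_compose[of "\<lambda>s. q + s *\<^sub>R w" "\<lambda>u. u *\<^sub>R w" 0 UNIV \<psi> "\<psi>' q", THEN has_derivative_eq_rhs] simp: linear_cmul)
    ultimately show "\<psi>' q w \<in> tangent_space H p"
      using e(1) q(3) unfolding tangent_space_def by (auto intro!: exI[of _ e] exI[of _ ?\<gamma>])
  qed
  ultimately show thesis using that linear_subspace_image[OF lin W] by blast
qed

text \<open>A set of velocities is not a subspace by definition, so it is squeezed between two. As
  \<open>f\<close> is constant along curves in \<open>H\<close>, it lies in the hyperplane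
  orthogonal to \<open>n\<close>; it contains a subspace of the same dimension, which must be that
  hyperplane.\<close>

lemma tangent_space_level_set:
  fixes H :: "(real ^ 'n::finite) set" and f :: "real ^ 'n \<Rightarrow> real"
  assumes H: "smooth_hypersurface H" and p: "p \<in> H" and Hf: "H \<subseteq> {x. f x = c}"
    and f': "(f has_derivative (\<lambda>v. n \<bullet> v)) (at p)" and n: "n \<noteq> 0"
  shows "tangent_space H p = {v. n \<bullet> v = 0}"
proof -
  have sub: "tangent_space H p \<subseteq> {v. n \<bullet> v = 0}"
  proof
    fix v assume "v \<in> tangent_space H p"
    then obtain e \<gamma> where e: "e > 0" and \<gamma>: "\<gamma> ` {-e<..<e} \<subseteq> H" "\<gamma> 0 = p"
      and v: "(\<gamma> has_derivative (\<lambda>s. s *\<^sub>R v)) (at 0)"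
      unfolding tangent_space_def has_vector_derivative_def by auto
    have "((\<lambda>s. f (\<gamma> s)) has_derivative (\<lambda>s. n \<bullet> (s *\<^sub>R v))) (at 0)"
      using has_derivative_compose[OF v, of f "\<lambda>v. n \<bullet> v"] f' \<gamma>(2) by simp
    then have "((\<lambda>s. c) has_derivative (\<lambda>s. n \<bullet> (s *\<^sub>R v))) (at 0)"
      by (rule has_derivative_transform_within_open[of _ _ _ _ "{-e<..<e}"]) (use e \<gamma>(1) Hf in \<open>simp_all add: image_subset_iff subset_iff\<close>)
    then have "(\<lambda>s. n \<bullet> (s *\<^sub>R v)) = (\<lambda>s. 0)" by (rule has_derivative_unique) simp
    from fun_cong[OF this, of 1] show "v \<in> {v. n \<bullet> v = 0}" by simp
  qed
  obtain V where V: "subspace V" "dim V = CARD('n) - 1" "V \<subseteq> tangent_space H p"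
    using hypersurface_tangent_space_superset[OF H p] by blast
  have "dim {v. n \<bullet> v = 0} = CARD('n) - 1" using dim_hyperplane[OF n] by simp
  then have "V = {v. n \<bullet> v = 0}"
    using V sub by (intro subspace_dim_equal) (auto simp: subspace_hyperplane)
  then show ?thesis using V sub by blast
qed

section \<open>Derivatives of the cubic and of the prepotential\<close>

text \<open>The polarization of six times the cubic, through which all derivatives below are
  expressed. It is polymorphic because it occurs at real \<open>t\<close> and at complex
  \<open>z\<close>.\<close>

definition tri :: "('n::finite \<Rightarrow> 'n \<Rightarrow> 'n \<Rightarrow> real) \<Rightarrow> 'a::real_normed_field ^ 'n \<Rightarrow> 'a ^ 'n \<Rightarrow> 'a ^ 'n \<Rightarrow> 'a" where
  "tri k s t u = (\<Sum>a\<in>UNIV. \<Sum>b\<in>UNIV. \<Sum>c\<in>UNIV. of_real (k a b c) * s $ a * t $ b * u $ c)"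

lemma cubic_eq_tri: "cubic k t = tri k t t t / 6"
  by (simp add: cubic_def tri_def)

lemma tri_add:
  "tri k (s + s') t u = tri k s t u + tri k s' t u"
  "tri k s (t + t') u = tri k s t u + tri k s t' u"
  "tri k s t (u + u') = tri k s t u + tri k s t u'"
  by (simp_all add: tri_def algebra_simps sum.distrib)

lemma tri_scale:
  "tri k (c *s s) t u = c * tri k s t u"
  "tri k s (c *s t) u = c * tri k s t u"
  "tri k s t (c *s u) = c * tri k s t u"
  by (simp_all add: tri_def sum_distrib_left algebra_simps)

lemma tri_scaleR:
  fixes s :: "real ^ 'n::finite"
  shows "tri k (c *\<^sub>R s) t u = c * tri k s t u"
    "tri k s (c *\<^sub>R t) u = c * tri k s t u"
    "tri k s t (c *\<^sub>R u) = c * tri k s t u"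
  by (simp_all add: tri_scale flip: scalar_mult_eq_scaleR)

lemma tri_zero [simp]: "tri k 0 t u = 0" "tri k s 0 u = 0" "tri k s t 0 = 0"
  by (simp_all add: tri_def)

lemma tri_diff:
  fixes s :: "real ^ 'n::finite"
  shows "tri k s t (u - u') = tri k s t u - tri k s t u'"
  using tri_add(3)[of k s t u' "u - u'"] by simp

lemma tri_expand: "tri k s t u = (\<Sum>c\<in>UNIV. tri k s t (axis c 1) * u $ c)"
proof -
  have e: "(\<Sum>c\<in>UNIV. of_real (k a b c) * s $ a * t $ b * axis d 1 $ c) = of_real (k a b d) * s $ a * t $ b" for a b d
    by (simp add: axis_def if_distrib[of "\<lambda>x. _ * x"] cong: if_cong)
  have "(\<Sum>c\<in>UNIV. tri k s t (axis c 1) * u $ c)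
      = (\<Sum>c\<in>UNIV. \<Sum>a\<in>UNIV. \<Sum>b\<in>UNIV. of_real (k a b c) * s $ a * t $ b * u $ c)"
    unfolding tri_def e sum_distrib_right ..
  also have "\<dots> = (\<Sum>a\<in>UNIV. \<Sum>c\<in>UNIV. \<Sum>b\<in>UNIV. of_real (k a b c) * s $ a * t $ b * u $ c)"
    by (rule sum.swap)
  also have "\<dots> = tri k s t u"
    unfolding tri_def by (rule arg_cong[where f = "\<lambda>f. sum f UNIV"], rule ext, rule sum.swap)
  finally show ?thesis ..
qed

definition cvec :: "real ^ 'm \<Rightarrow> complex ^ 'm" where "cvec v = (\<chi> a. of_real (v $ a))"

text \<open>The image under \<open>shear b\<close> of the basis vector with index \<open>i\<close>;
  compare \<open>shear_eq_sum\<close>.\<close>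

definition N_arg :: "real ^ 'n \<Rightarrow> 'n::finite option \<Rightarrow> real ^ 'n" where
  "N_arg b i = (case i of None \<Rightarrow> - b | Some a \<Rightarrow> axis a 1)"

definition shear :: "real ^ 'n \<Rightarrow> real ^ 'n::finite option \<Rightarrow> real ^ 'n" where
  "shear b y = (\<chi> a. y $ Some a - y $ None * b $ a)"

context
  fixes k :: "'n::finite \<Rightarrow> 'n \<Rightarrow> 'n \<Rightarrow> real"
  assumes sym: "symmetric_coeffs k"
begin

lemma tri_swap: "tri k s t u = tri k t s u" "tri k s t u = tri k s u t"
proof -
  have k: "k a b c = k b a c" "k a b c = k a c b" for a b c
    using sym by (auto simp: symmetric_coeffs_def)
  have "tri k s t u = (\<Sum>b\<in>UNIV. \<Sum>a\<in>UNIV. \<Sum>c\<in>UNIV. of_real (k a b c) * s $ a * t $ b * u $ c)"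
    unfolding tri_def by (rule sum.swap)
  also have "\<dots> = (\<Sum>b\<in>UNIV. \<Sum>a\<in>UNIV. \<Sum>c\<in>UNIV. of_real (k b a c) * t $ b * s $ a * u $ c)"
    by (intro arg_cong[where f = "\<lambda>f. sum f UNIV"] ext) (simp add: k(1) mult_ac)
  finally show "tri k s t u = tri k t s u" by (simp only: tri_def)
  have "tri k s t u = (\<Sum>a\<in>UNIV. \<Sum>c\<in>UNIV. \<Sum>b\<in>UNIV. of_real (k a b c) * s $ a * t $ b * u $ c)"
    unfolding tri_def by (rule arg_cong[where f = "\<lambda>f. sum f UNIV"], rule ext, rule sum.swap)
  also have "\<dots> = (\<Sum>a\<in>UNIV. \<Sum>c\<in>UNIV. \<Sum>b\<in>UNIV. of_real (k a c b) * s $ a * u $ c * t $ b)"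
    by (intro arg_cong[where f = "\<lambda>f. sum f UNIV"] ext) (metis (no_types, lifting) k(2) mult.assoc mult.commute)
  finally show "tri k s t u = tri k s u t" by (simp only: tri_def)
qed

text \<open>All three transpositions of the arguments, so that ordered rewriting brings equal values
  of \<open>tri\<close> to a common form.\<close>

lemma tri_commute: "tri k s t u = tri k t s u" "tri k s t u = tri k u t s" "tri k s t u = tri k s u t"
proof -
  show "tri k s t u = tri k t s u" "tri k s t u = tri k s u t" by (fact tri_swap)+
  have "tri k s t u = tri k t s u" by (rule tri_swap)
  also have "\<dots> = tri k t u s" by (rule tri_swap)
  also have "\<dots> = tri k u t s" by (rule tri_swap)
  finally show "tri k s t u = tri k u t s" .
qed

section \<open>Partial derivatives of the cubic and of its logarithm\<close>

lemma axis_eq_scale: "axis i s = s *s axis i (1 :: 'a::real_normed_field)"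
  by (simp add: vec_eq_iff axis_def)

lemma axis_zero: "axis i 0 = 0"
  by (simp add: axis_eq_0_iff)

lemma DERIV_tri_axis:
  fixes e x :: "'a::real_normed_field ^ 'n"
  shows "((\<lambda>s. tri k e (x + axis i s) (x + axis i s)) has_field_derivative 2 * tri k (axis i 1) e x) (at 0)"
proof -
  have "tri k e (x + axis i s) (x + axis i s)
     = tri k e x x + s * (2 * tri k (axis i 1) e x) + s\<^sup>2 * tri k e (axis i 1) (axis i 1)" for s
    by (simp add: axis_eq_scale[of i s] tri_add tri_scale tri_commute algebra_simps power2_eq_square)
  then show ?thesis by (auto intro!: derivative_eq_intros)
qed

lemma DERIV_cubic_axis:
  fixes x :: "'a::real_normed_field ^ 'n"
  shows "((\<lambda>s. cubic k (x + axis i s)) has_field_derivative tri k (axis i 1) x x / 2) (at 0)"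
proof -
  let ?e = "axis i 1"
  have *: "cubic k (x + axis i s)
     = (tri k x x x + s * (3 * tri k ?e x x) + s\<^sup>2 * (3 * tri k ?e ?e x) + s ^ 3 * tri k ?e ?e ?e) / 6" for s
    by (simp add: cubic_eq_tri axis_eq_scale[of i s] tri_add tri_scale tri_commute algebra_simps
        power2_eq_square power3_eq_cube)
  show ?thesis unfolding * by (auto intro!: derivative_eq_intros)
qed

lemma partial_cubic: "partial i (cubic k) x = tri k (axis i 1) x x / 2"
  unfolding partial_def by (rule DERIV_imp_deriv[OF DERIV_cubic_axis])

lemma hessian_cubic: "hessian (cubic k) x $ i $ j = tri k x (axis i 1) (axis j 1)"
proof -
  have "((\<lambda>s. partial j (cubic k) (x + axis i s)) has_field_derivative tri k (axis i 1) (axis j 1) x) (at 0)"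
    unfolding partial_cubic by (auto intro!: derivative_eq_intros DERIV_tri_axis)
  from DERIV_imp_deriv[OF this] show ?thesis
    by (simp add: hessian_def partial_def[of i] tri_commute)
qed

lemma has_derivative_cubic:
  fixes x :: "real ^ 'n"
  shows "(cubic k has_derivative (\<lambda>v. tri k v x x / 2)) (at x)"
proof -
  have [derivative_intros]: "((\<lambda>x. x $ a) has_derivative (\<lambda>v. v $ a)) (at x)" for a
    by (simp add: bounded_linear_imp_has_derivative bounded_linear_vec_nth)
  have "(cubic k has_derivative (\<lambda>v. (tri k v x x + tri k x v x + tri k x x v) / 6)) (at x)"
    unfolding cubic_def[abs_def] tri_def
    by (auto intro!: derivative_eq_intros simp: sum.distrib algebra_simps)
  also have "(\<lambda>v. (tri k v x x + tri k x v x + tri k x x v) / 6) = (\<lambda>v. tri k v x x / 2)"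
  proof
    fix v
    show "(tri k v x x + tri k x v x + tri k x x v) / 6 = tri k v x x / 2"
      using tri_commute(1)[of x v x] tri_commute(2)[of x x v] by simp
  qed
  finally show ?thesis .
qed

lemma hessian_ln_cubic:
  fixes t :: "real ^ 'n"
  assumes pos: "0 < cubic k t"
  shows "hessian (\<lambda>t. ln (cubic k t)) t $ i $ j =
    tri k t (axis i 1) (axis j 1) / cubic k t - (tri k t t (axis i 1) / 2) * (tri k t t (axis j 1) / 2) / (cubic k t)\<^sup>2"
proof -
  have 1: "partial j (\<lambda>t. ln (cubic k t)) x = tri k (axis j 1) x x / 2 / cubic k x" if "0 < cubic k x" for x :: "real ^ 'n"
  proof -
    have "((\<lambda>s. ln (cubic k (x + axis j s))) has_field_derivative 1 / cubic k (x + axis j 0) * (tri k (axis j 1) x x / 2)) (at 0)"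
      by (rule DERIV_chain2[OF DERIV_ln_divide DERIV_cubic_axis]) (simp add: that axis_zero)
    from DERIV_imp_deriv[OF this] show ?thesis by (simp add: partial_def axis_zero)
  qed
  \<comment> \<open>The second derivative needs the formula for the first one along the whole line
    near \<open>t\<close>, hence positivity of the cubic nearby.\<close>
  have "isCont (\<lambda>s. cubic k (t + axis i s)) 0"
    by (rule DERIV_isCont[OF DERIV_cubic_axis])
  then have "\<forall>\<^sub>F s in nhds 0. 0 < cubic k (t + axis i s)"
    using pos by (simp add: isCont_def tendsto_at_iff_tendsto_nhds[symmetric] order_tendstoD(1) eventually_nhds_conv_at axis_zero)
  then have 2: "\<forall>\<^sub>F s in nhds 0. partial j (\<lambda>t. ln (cubic k t)) (t + axis i s)
      = tri k (axis j 1) (t + axis i s) (t + axis i s) / 2 / cubic k (t + axis i s)"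
    by eventually_elim (rule 1)
  have "((\<lambda>s. tri k (axis j 1) (t + axis i s) (t + axis i s) / 2 / cubic k (t + axis i s)) has_field_derivative
     tri k (axis i 1) (axis j 1) t / cubic k t - (tri k (axis i 1) t t / 2) * (tri k (axis j 1) t t / 2) / (cubic k t)\<^sup>2) (at 0)"
    using pos by (auto intro!: derivative_eq_intros DERIV_cubic_axis DERIV_tri_axis simp: axis_zero power2_eq_square field_simps)
  then have "((\<lambda>s. partial j (\<lambda>t. ln (cubic k t)) (t + axis i s)) has_field_derivative
     tri k (axis i 1) (axis j 1) t / cubic k t - (tri k (axis i 1) t t / 2) * (tri k (axis j 1) t t / 2) / (cubic k t)\<^sup>2) (at 0)"
    by (subst DERIV_cong_ev[OF refl 2 refl])
  from DERIV_imp_deriv[OF this] show ?thesis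
    by (simp add: hessian_def partial_def[of i] tri_commute)
qed

section \<open>The Hessian of the prepotential\<close>

lemma partial_prepotential:
  "partial (Some a) (prepotential k) X = - tri k (axis a 1) (\<chi> b. X $ Some b) (\<chi> b. X $ Some b) / (2 * X $ None)"
  "X $ None \<noteq> 0 \<Longrightarrow> partial None (prepotential k) X = cubic k (\<chi> b. X $ Some b) / (X $ None)\<^sup>2"
proof -
  have *: "(\<chi> b. (X + axis (Some a) s) $ Some b) = (\<chi> b. X $ Some b) + axis a s" for s
    by (simp add: vec_eq_iff axis_def)
  have **: "(X + axis (Some a) s) $ None = X $ None" for s by (simp add: axis_def)
  \<comment> \<open>For \<open>c = 0\<close> both quotients are \<open>0\<close> by convention, so
    the rule covers every value of \<open>X $ None\<close>.\<close>
  have c: "(f has_field_derivative d) (at 0) \<Longrightarrow> ((\<lambda>s. - f s / c) has_field_derivative - d / c) (at 0)" for f d and c :: complex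
    by (cases "c = 0") (auto intro!: derivative_eq_intros)
  show "partial (Some a) (prepotential k) X = - tri k (axis a 1) (\<chi> b. X $ Some b) (\<chi> b. X $ Some b) / (2 * X $ None)"
    unfolding partial_def prepotential_def * **
    by (rule DERIV_imp_deriv, rule c[OF DERIV_cubic_axis, THEN DERIV_cong]) simp
  have *: "(\<chi> b. (X + axis None s) $ Some b) = (\<chi> b. X $ Some b)" for s
    by (simp add: vec_eq_iff axis_def)
  have **: "(X + axis None s) $ None = X $ None + s" for s by (simp add: axis_def)
  show "X $ None \<noteq> 0 \<Longrightarrow> partial None (prepotential k) X = cubic k (\<chi> b. X $ Some b) / (X $ None)\<^sup>2"
    unfolding partial_def prepotential_def * **
    by (rule DERIV_imp_deriv) (auto intro!: derivative_eq_intros simp: power2_eq_square)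
qed

lemma tau_mat_simps:
  "tau_mat k z $ Some a $ Some b = - tri k z (axis a 1) (axis b 1)"
  "tau_mat k z $ Some a $ None = tri k z z (axis a 1) / 2"
  "tau_mat k z $ None $ Some b = tri k z z (axis b 1) / 2"
  "tau_mat k z $ None $ None = - tri k z z z / 3"
proof -
  have X: "(\<chi> b. extend z $ Some b) = z" "extend z $ None = 1" by (simp_all add: extend_def vec_eq_iff)
  have S: "(\<chi> b. (extend z + axis (Some a) s) $ Some b) = z + axis a s" "(extend z + axis (Some a) s) $ None = 1" for s and a :: 'n
    by (simp_all add: vec_eq_iff axis_def extend_def)
  have N: "(\<chi> b. (extend z + axis None s) $ Some b) = z" "(extend z + axis None s) $ None = 1 + s" for s
    by (simp_all add: vec_eq_iff axis_def extend_def)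
  have "((\<lambda>s. - tri k (axis b 1) (z + axis a s) (z + axis a s) / (2 * 1)) has_field_derivative - tri k z (axis a 1) (axis b 1)) (at 0)" for a b
    by (auto intro!: derivative_eq_intros DERIV_tri_axis simp: tri_commute)
  from DERIV_imp_deriv[OF this]
  show "tau_mat k z $ Some a $ Some b = - tri k z (axis a 1) (axis b 1)"
    by (simp add: tau_mat_def hessian_def partial_def[of "Some a"] partial_prepotential S del: vector_add_component)
  have "((\<lambda>s. - tri k (axis b 1) z z / (2 * (1 + s))) has_field_derivative tri k z z (axis b 1) / 2) (at 0)" for b
    by (auto intro!: derivative_eq_intros simp: tri_commute)
  from DERIV_imp_deriv[OF this]
  show "tau_mat k z $ None $ Some b = tri k z z (axis b 1) / 2"
    by (simp add: tau_mat_def hessian_def partial_def[of "None"] partial_prepotential N del: vector_add_component)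
  have "((\<lambda>s. cubic k (z + axis a s)) has_field_derivative tri k z z (axis a 1) / 2) (at 0)" for a
    by (rule DERIV_cong[OF DERIV_cubic_axis]) (simp add: tri_commute)
  from DERIV_imp_deriv[OF this]
  show "tau_mat k z $ Some a $ None = tri k z z (axis a 1) / 2"
    by (simp add: tau_mat_def hessian_def partial_def[of "Some a"] partial_prepotential S del: vector_add_component)
  \<comment> \<open>The formula for \<open>partial None\<close> divides by the coordinate
    \<open>1 + s\<close>, which is nonzero only away from \<open>s = -1\<close>; near
    \<open>0\<close> this suffices.\<close>
  have ev: "\<forall>\<^sub>F s in nhds 0. partial None (prepotential k) (extend z + axis None s) = cubic k z / (1 + s)\<^sup>2"
  proof -
    have "\<forall>\<^sub>F s in nhds (0::complex). s \<noteq> -1" by (rule t1_space_nhds) simp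
    then show ?thesis
    proof eventually_elim
      case (elim s)
      then have "1 + s \<noteq> 0" by (metis add.commute add_eq_0_iff)
      then show ?case by (simp add: partial_prepotential N del: vector_add_component)
    qed
  qed
  have "((\<lambda>s. cubic k z / (1 + s)\<^sup>2) has_field_derivative - tri k z z z / 3) (at 0)"
    by (auto intro!: derivative_eq_intros simp: cubic_eq_tri)
  then have "((\<lambda>s. partial None (prepotential k) (extend z + axis None s)) has_field_derivative - tri k z z z / 3) (at 0)"
    by (subst DERIV_cong_ev[OF refl ev refl])
  from DERIV_imp_deriv[OF this] show "tau_mat k z $ None $ None = - tri k z z z / 3"
    by (simp add: tau_mat_def hessian_def partial_def[of "None"])
qed

section \<open>The matrix \<open>N\<close> in terms of real and imaginary parts\<close>

lemma tri_cvec: "tri k (cvec s) (cvec t) (cvec u) = of_real (tri k s t u)"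
  by (simp add: tri_def cvec_def)

lemma cvec_axis: "cvec (axis a 1) = axis a 1"
  by (simp add: cvec_def axis_def vec_eq_iff)

lemma complex_vec_eq: "z = cvec (re_part z) + \<i> *s cvec (im_part z)"
  by (simp add: vec_eq_iff cvec_def re_part_def im_part_def complex_eq)

text \<open>In the variables \<open>y\<^sup>0\<close> and \<open>y\<^sup>a - y\<^sup>0 b\<^sup>a\<close> the form \<open>N\<close> splits into \<open>2 \<partial>\<^sup>2h(t)\<close> and \<open>-4 h(t)\<close>;
  \<open>N_arg\<close> and \<open>shear\<close> carry out this change of variables.\<close>

lemma N_mat_eq:
  "N_mat k z $ i $ j = 2 * tri k (im_part z) (N_arg (re_part z) i) (N_arg (re_part z) j)
     - (if i = None \<and> j = None then 4 * cubic k (im_part z) else 0)"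
proof -
  define b t where "b = re_part z" and "t = im_part z"
  have z: "z = cvec b + \<i> *s cvec t" unfolding b_def t_def by (rule complex_vec_eq)
  have m: "tri k s t (- u) = - tri k s t u" "tri k s (- t) u = - tri k s t u" for s t u :: "real ^ 'n"
    by (simp_all add: tri_def sum_negf)
  have "Im (tri k z (axis a 1) (axis c 1)) = tri k t (axis a 1) (axis c 1)" for a c
    by (simp add: z tri_add tri_scale tri_cvec flip: cvec_axis)
  moreover have "Im (tri k z z (axis a 1)) = 2 * tri k t b (axis a 1)" for a
    by (simp add: z tri_add tri_scale tri_cvec tri_commute flip: cvec_axis)
  moreover have "Im (tri k z z z) = 3 * tri k t b b - tri k t t t"
    by (simp add: z tri_add tri_scale tri_cvec tri_commute flip: cvec_axis)
  ultimately show ?thesis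
    unfolding N_mat_def b_def[symmetric] t_def[symmetric]
    by (cases i; cases j) (simp_all add: tau_mat_simps N_arg_def m cubic_eq_tri tri_commute)
qed

lemma shear_eq_sum: "shear b y = (\<Sum>i\<in>UNIV. y $ i *\<^sub>R N_arg b i)"
  by (simp add: vec_eq_iff shear_def sum_UNIV_option N_arg_def axis_def if_distrib[of "\<lambda>x. _ * x"] cong: if_cong)

lemma N_mat_bilinear:
  "x \<bullet> (N_mat k z *v y) = 2 * tri k (im_part z) (shear (re_part z) x) (shear (re_part z) y)
     - 4 * cubic k (im_part z) * x $ None * y $ None"
proof -
  define T where "T = tri k (im_part z)"
  define a where "a = N_arg (re_part z)"
  have s1: "T (sum f I) v = (\<Sum>i\<in>I. T (f i) v)" for f and I :: "'n option set" and v
    by (induction I rule: infinite_finite_induct) (simp_all add: T_def tri_add)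
  have s2: "T v (sum f I) = (\<Sum>i\<in>I. T v (f i))" for f and I :: "'n option set" and v
    by (induction I rule: infinite_finite_induct) (simp_all add: T_def tri_add)
  have T: "T (shear (re_part z) x) (shear (re_part z) y) = (\<Sum>i\<in>UNIV. \<Sum>j\<in>UNIV. x $ i * (T (a i) (a j) * y $ j))"
    unfolding shear_eq_sum s1 unfolding s2 a_def
    by (simp add: T_def tri_scaleR sum_distrib_left mult_ac)
  have "x \<bullet> (N_mat k z *v y) = (\<Sum>i\<in>UNIV. \<Sum>j\<in>UNIV. x $ i * (N_mat k z $ i $ j * y $ j))"
    by (simp add: inner_vec_def matrix_vector_mult_def sum_distrib_left)
  also have "\<dots> = (\<Sum>i\<in>UNIV. \<Sum>j\<in>UNIV. 2 * (x $ i * (T (a i) (a j) * y $ j)) -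
       (if i = None then if j = None then 4 * cubic k (im_part z) * x $ None * y $ None else 0 else 0))"
    unfolding N_mat_eq T_def a_def by (intro sum.cong refl) (simp add: algebra_simps)
  also have "\<dots> = 2 * T (shear (re_part z) x) (shear (re_part z) y) - 4 * cubic k (im_part z) * x $ None * y $ None"
    unfolding sum_subtractf T sum_distrib_left by (simp add: sum_UNIV_option)
  finally show ?thesis by (simp add: T_def)
qed

end

section \<open>The metric on the fiber\<close>

lemma sum_fiber_index:
  fixes f :: "'n::finite fiber_index \<Rightarrow> 'a::comm_monoid_add"
  shows "(\<Sum>i\<in>UNIV. f i) = f R_idx + f Rho_idx + f Sigma_idx + (\<Sum>a\<in>UNIV. f (B_idx a))
    + (\<Sum>l\<in>UNIV. f (Zetat_idx l)) + (\<Sum>l\<in>UNIV. f (Zeta_idx l))"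
proof -
  have "(\<Sum>i\<in>UNIV. f i) = (\<Sum>i\<in>{R_idx, Rho_idx, Sigma_idx} \<union> range B_idx \<union> range Zetat_idx. f i) + (\<Sum>i\<in>range Zeta_idx. f i)"
    unfolding UNIV_fiber_index by (rule sum.union_disjoint) auto
  also have "(\<Sum>i\<in>{R_idx, Rho_idx, Sigma_idx} \<union> range B_idx \<union> range Zetat_idx. f i)
      = (\<Sum>i\<in>{R_idx, Rho_idx, Sigma_idx} \<union> range B_idx. f i) + (\<Sum>i\<in>range Zetat_idx. f i)"
    by (rule sum.union_disjoint) auto
  also have "(\<Sum>i\<in>{R_idx, Rho_idx, Sigma_idx} \<union> range B_idx. f i)
      = (\<Sum>i\<in>{R_idx, Rho_idx, Sigma_idx}. f i) + (\<Sum>i\<in>range B_idx. f i)"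
    by (rule sum.union_disjoint) auto
  finally show ?thesis
    by (simp add: sum.reindex inj_on_def add.assoc)
qed

text \<open>The order in which the transition to the coframe is upper triangular: the form
  completing \<open>d\<sigma>\<close> involves both kinds of \<open>\<zeta>\<close>-differentials,
  and so does \<open>Re W\<close>, while \<open>Im W\<close> involves only
  \<open>d\<zeta>\<close>.\<close>

primrec fiber_block :: "'n fiber_index \<Rightarrow> nat" where
  "fiber_block Sigma_idx = 0"
| "fiber_block (Zetat_idx l) = 1"
| "fiber_block (Zeta_idx l) = 2"
| "fiber_block (B_idx a) = 3"
| "fiber_block R_idx = 4"
| "fiber_block Rho_idx = 5"

lemma det_block_triangular_fiber_index:
  fixes A :: "real ^ 'n::finite fiber_index ^ 'n fiber_index"
  assumes zero: "\<And>i j. fiber_block j < fiber_block i \<Longrightarrow> A $ i $ j = 0"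
  shows "det A = A $ Sigma_idx $ Sigma_idx * (det (\<chi> l m. A $ Zetat_idx l $ Zetat_idx m)
    * (det (\<chi> l m. A $ Zeta_idx l $ Zeta_idx m) * (det (\<chi> a b. A $ B_idx a $ B_idx b)
    * (A $ R_idx $ R_idx * A $ Rho_idx $ Rho_idx))))"
proof -
  let ?A = "\<lambda>i j. A $ i $ j"
  have split: "det_on (S \<union> S') ?A = det_on S ?A * det_on S' ?A"
    if "\<And>i j. i \<in> S' \<Longrightarrow> j \<in> S \<Longrightarrow> fiber_block j < fiber_block i" for S S'
    by (rule det_on_Un) (use that zero in \<open>force+\<close>)
  have "det A = det_on ({Sigma_idx} \<union> (range Zetat_idx \<union> (range Zeta_idx \<union> (range B_idx \<union> ({R_idx} \<union> {Rho_idx}))))) ?A"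
    unfolding det_eq_det_on by (rule arg_cong[where f = "\<lambda>S. det_on S ?A"]) (auto simp: UNIV_fiber_index)
  also have "\<dots> = det_on {Sigma_idx} ?A * (det_on (range Zetat_idx) ?A * (det_on (range Zeta_idx) ?A
      * (det_on (range B_idx) ?A * (det_on {R_idx} ?A * det_on {Rho_idx} ?A))))"
    by (subst split, force)+ (rule refl)
  finally show ?thesis
    by (simp add: det_on_range inj_on_def)
qed

text \<open>With real coefficients \<open>M\<close>, the real part gives one copy of
  \<open>M\<close> for the real and one for the imaginary parts. The complex rank one term is the
  product of one sum of \<open>z i * W i\<close> with the conjugate of the other, hence two real
  rank one terms.\<close>

lemma Re_rank_one_hermitian_form:
  fixes z W W' :: "'m::finite \<Rightarrow> complex" and M :: "'m \<Rightarrow> 'm \<Rightarrow> real"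
  shows "Re (\<Sum>i\<in>UNIV. \<Sum>j\<in>UNIV. (of_real (M i j) - of_real c * z i * cnj (z j)) * W i * cnj (W' j))
    = (\<Sum>i\<in>UNIV. \<Sum>j\<in>UNIV. M i j * (Re (W i) * Re (W' j) + Im (W i) * Im (W' j)))
     - c * (Re (\<Sum>i\<in>UNIV. z i * W i) * Re (\<Sum>i\<in>UNIV. z i * W' i) + Im (\<Sum>i\<in>UNIV. z i * W i) * Im (\<Sum>i\<in>UNIV. z i * W' i))"
proof -
  have "(\<Sum>i\<in>UNIV. \<Sum>j\<in>UNIV. (of_real (M i j) - of_real c * z i * cnj (z j)) * W i * cnj (W' j))
     = (\<Sum>i\<in>UNIV. \<Sum>j\<in>UNIV. of_real (M i j) * (W i * cnj (W' j)) - of_real c * ((z i * W i) * cnj (z j * W' j)))"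
    by (simp add: algebra_simps)
  also have "\<dots> = (\<Sum>i\<in>UNIV. \<Sum>j\<in>UNIV. of_real (M i j) * (W i * cnj (W' j)))
      - of_real c * (\<Sum>i\<in>UNIV. \<Sum>j\<in>UNIV. (z i * W i) * cnj (z j * W' j))"
    by (simp only: sum_subtractf sum_distrib_left)
  also have "(\<Sum>i\<in>UNIV. \<Sum>j\<in>UNIV. (z i * W i) * cnj (z j * W' j))
      = (\<Sum>i\<in>UNIV. z i * W i) * cnj (\<Sum>i\<in>UNIV. z i * W' i)"
    by (simp only: cnj_sum sum_product)
  finally have *: "(\<Sum>i\<in>UNIV. \<Sum>j\<in>UNIV. (of_real (M i j) - of_real c * z i * cnj (z j)) * W i * cnj (W' j))
    = (\<Sum>i\<in>UNIV. \<Sum>j\<in>UNIV. of_real (M i j) * (W i * cnj (W' j)))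
      - of_real c * ((\<Sum>i\<in>UNIV. z i * W i) * cnj (\<Sum>i\<in>UNIV. z i * W' i))" .
  have "Re (X - of_real c * (S * cnj S')) = Re X - c * (Re S * Re S' + Im S * Im S')" for X S S'
    by simp
  then show ?thesis by (simp only: *) (simp add: Re_sum)
qed

lemma matrix_mul_matrix_inv:
  fixes A :: "real ^ 'n::finite ^ 'n"
  assumes "invertible A"
  shows "A ** matrix_inv A = mat 1" "matrix_inv A ** A = mat 1"
proof -
  have "\<exists>A'. A ** A' = mat 1 \<and> A' ** A = mat 1" using assms by (simp add: invertible_def)
  then show "A ** matrix_inv A = mat 1" "matrix_inv A ** A = mat 1"
    unfolding matrix_inv_def by (metis (mono_tags, lifting) someI_ex)+
qed

section \<open>The geometry over one point of the hypersurface\<close>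

text \<open>A point of the q-map space with a decomposition of its imaginary part;
  \<open>radius_x\<close> and \<open>psr_proj_x\<close> identify \<open>r\<close> and
  \<open>p\<close> as radius and projection.\<close>

locale qmap_point =
  fixes k :: "'n::finite \<Rightarrow> 'n \<Rightarrow> 'n \<Rightarrow> real" and H :: "(real ^ 'n) set"
    and z :: "complex ^ 'n" and \<rho> :: real and \<zeta>t \<zeta> :: "real ^ 'n option" and \<sigma> :: real
    and p :: "real ^ 'n" and r :: real
  assumes psr: "psr_manifold k H" and p: "p \<in> H" and r: "0 < r" and \<rho>: "0 < \<rho>"
    and t: "im_part z = r *\<^sub>R p"
begin

abbreviation "x \<equiv> (z, \<rho>, \<zeta>t, \<zeta>, \<sigma>)"
abbreviation "T \<equiv> tri k"

lemma sym: "symmetric_coeffs k"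
  using psr by (simp add: psr_manifold_def)

lemmas T_commute = tri_commute[OF sym]

lemma T_ppp: "T p p p = 6"
proof -
  have "cubic k p = 1" using psr p by (auto simp: psr_manifold_def)
  then show ?thesis by (simp add: cubic_eq_tri)
qed

lemma cubic_t: "cubic k (im_part z) = r ^ 3"
  by (simp add: t cubic_eq_tri tri_scaleR T_ppp power3_eq_cube)

lemma cubic_t_pos: "0 < cubic k (im_part z)"
  using r by (simp add: cubic_t)

lemma radius_x: "radius k x = r"
  using r by (simp add: radius_def cubic_t real_root_power_cancel)

lemma psr_proj_x: "psr_proj k x = p"
  using r by (simp add: psr_proj_def radius_x t)

definition A :: "real ^ 'n ^ 'n" where "A = hessian (cubic k) p"

lemma A_bilinear: "v \<bullet> (A *v w) = T p v w"
proof -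
  have "v \<bullet> (A *v w) = (\<Sum>a\<in>UNIV. \<Sum>b\<in>UNIV. T p (axis a 1) (axis b 1) * w $ b * v $ a)"
    by (simp add: inner_vec_def matrix_vector_mult_def A_def hessian_cubic[OF sym] sum_distrib_left mult_ac)
  also have "\<dots> = (\<Sum>a\<in>UNIV. T p (axis a 1) w * v $ a)"
    by (simp add: tri_expand[of k p _ w] sum_distrib_right)
  also have "\<dots> = (\<Sum>a\<in>UNIV. T p w (axis a 1) * v $ a)"
    by (simp only: T_commute(3)[of p w])
  also have "\<dots> = T p w v" by (rule tri_expand[symmetric])
  finally show ?thesis by (simp add: T_commute)
qed

text \<open>The gradient \<open>n\<close> of the cubic at \<open>p\<close> is nonzero, since by
  Euler's identity its product with \<open>p\<close> is 3; thus the tangent space is its orthogonal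
  complement.\<close>

lemma tangent_space_p: "tangent_space H p = {v. T p p v = 0}"
proof -
  define n where "n = (1/2) *\<^sub>R (A *v p)"
  have n: "T v p p / 2 = n \<bullet> v" for v
    by (simp add: n_def inner_commute[of _ v] A_bilinear T_commute)
  have "tangent_space H p = {v. n \<bullet> v = 0}"
  proof (rule tangent_space_level_set)
    show "smooth_hypersurface H" "H \<subseteq> {t. cubic k t = 1}" using psr by (auto simp: psr_manifold_def)
    show "(cubic k has_derivative (\<lambda>v. n \<bullet> v)) (at p)"
      using has_derivative_cubic[OF sym, of p] by (simp add: n)
    show "n \<noteq> 0" using n[of p] T_ppp by auto
  qed (fact p)
  then show ?thesis by (simp add: n[symmetric] T_commute)
qed

lemma T_neg: "T p p v = 0 \<Longrightarrow> v \<noteq> 0 \<Longrightarrow> T p v v < 0"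
proof -
  assume v: "T p p v = 0" "v \<noteq> 0"
  then have "v \<in> tangent_space H p" by (simp add: tangent_space_p)
  then have "0 < - (\<Sum>a\<in>UNIV. \<Sum>b\<in>UNIV. hessian (cubic k) p $ a $ b * v $ a * v $ b)"
    using psr p v by (auto simp: psr_manifold_def)
  also have "(\<Sum>a\<in>UNIV. \<Sum>b\<in>UNIV. hessian (cubic k) p $ a $ b * v $ a * v $ b) = v \<bullet> (A *v v)"
    by (simp add: inner_vec_def matrix_vector_mult_def A_def sum_distrib_left mult_ac)
  finally show ?thesis by (simp add: A_bilinear)
qed

text \<open>Testing with \<open>p\<close> puts \<open>u\<close> into the tangent space, where
  testing with \<open>u\<close> itself contradicts negativity unless \<open>u = 0\<close>.\<close>

lemma T_nondegenerate:
  assumes "\<And>w. T p w u = 0" shows "u = 0"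
  using T_neg[of u] assms[of p] assms[of u] by force

text \<open>Splits a vector into a multiple of \<open>p\<close> and a tangent vector; the divisor 6
  is \<open>T p p p\<close>.\<close>

lemma T_decompose:
  obtains u where "v = (T p p v / 6) *\<^sub>R p + u" "T p p u = 0"
proof (rule that)
  show "v = (T p p v / 6) *\<^sub>R p + (v - (T p p v / 6) *\<^sub>R p)" by simp
  show "T p p (v - (T p p v / 6) *\<^sub>R p) = 0" by (simp add: tri_diff tri_scaleR T_ppp)
qed

text \<open>The common matrix of the \<open>db\<close>- and \<open>dt\<close>-parts of the base
  metric.\<close>

definition Bm :: "real ^ 'n ^ 'n" where
  "Bm = (\<chi> a b. - (1/4) * hessian (\<lambda>t. ln (cubic k t)) (im_part z) $ a $ b)"

text \<open>The Hessian of the logarithm is homogeneous of degree -2, which leaves its value at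
  \<open>p\<close>. There the cubic is 1 and its gradient is half of \<open>A *v p\<close>, whence
  the divisor 4.\<close>

lemma Bm_entry: "Bm $ a $ b = - (1 / (4 * r\<^sup>2)) * (A $ a $ b - (A *v p) $ a * (A *v p) $ b / 4)"
proof -
  have g: "(A *v p) $ a = T p p (axis a 1)" for a
  proof -
    have "(A *v p) $ a = axis a 1 \<bullet> (A *v p)" by (simp add: inner_axis')
    then show ?thesis by (simp only: A_bilinear T_commute)
  qed
  show ?thesis
    unfolding Bm_def g vec_lambda_beta hessian_ln_cubic[OF sym cubic_t_pos] cubic_t
    unfolding t
    using r by (simp add: tri_scaleR A_def hessian_cubic[OF sym] field_simps power2_eq_square power3_eq_cube)
qed

lemma Bm_bilinear: "v \<bullet> (Bm *v w) = - (1 / (4 * r\<^sup>2)) * (T p v w - T p p v * T p p w / 4)"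
proof -
  have g: "(A *v p) \<bullet> u = T p p u" for u
    by (simp add: inner_commute[of _ u] A_bilinear T_commute)
  have e: "Bm *v w = - (1 / (4 * r\<^sup>2)) *\<^sub>R (A *v w - (((A *v p) \<bullet> w) / 4) *\<^sub>R (A *v p))"
  proof (rule vec_eq_iff[THEN iffD2, rule_format])
    fix a
    have "(Bm *v w) $ a = (\<Sum>b\<in>UNIV. - (1 / (4 * r\<^sup>2)) * (A $ a $ b * w $ b - (A *v p) $ a * ((A *v p) $ b * w $ b) / 4))"
      unfolding matrix_vector_mult_def[of Bm] Bm_entry by (auto intro!: sum.cong simp: algebra_simps)
    also have "\<dots> = - (1 / (4 * r\<^sup>2)) * ((A *v w) $ a - (A *v p) $ a * ((A *v p) \<bullet> w) / 4)"
      by (simp add: sum_distrib_left sum_subtractf sum_divide_distrib sum_negf matrix_vector_mult_def[of A w]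
          inner_vec_def right_diff_distrib mult.assoc)
    finally show "(Bm *v w) $ a = (- (1 / (4 * r\<^sup>2)) *\<^sub>R (A *v w - (((A *v p) \<bullet> w) / 4) *\<^sub>R (A *v p))) $ a"
      by simp
  qed
  show ?thesis
    unfolding e inner_scaleR_right inner_diff_right A_bilinear g
    by (simp add: T_commute(3)[of p v p])
qed

lemma det_A_nz: "det A \<noteq> 0"
proof -
  have "u = v" if "A *v u = A *v v" for u v
  proof -
    have "T p w (u - v) = 0" for w
      by (simp add: A_bilinear[symmetric] matrix_vector_mult_diff_distrib that)
    then show ?thesis using T_nondegenerate[of "u - v"] by simp
  qed
  then have "inj ((*v) A)" by (rule injI)
  then show ?thesis using det_nz_iff_inj[of "(*v) A"] by simp
qed

text \<open>The Hessian of the cubic is positive along \<open>p\<close> and negative on the tangent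
  space. For \<open>v = c p + u\<close> the rank one term turns the contribution
  \<open>6 c^2\<close> of \<open>p\<close> into \<open>-3 c^2\<close>, so the bracket in
  \<open>Bm_bilinear\<close> is negative definite.\<close>

lemma Bm_pos: "v \<noteq> 0 \<Longrightarrow> 0 < v \<bullet> (Bm *v v)"
proof -
  assume v: "v \<noteq> 0"
  obtain u where u: "v = (T p p v / 6) *\<^sub>R p + u" "T p p u = 0" by (rule T_decompose)
  define c where "c = T p p v / 6"
  have vc: "v = c *\<^sub>R p + u" unfolding c_def by (rule u(1))
  have 1: "T p p v = 6 * c" by (simp add: c_def)
  have 2: "T p v v = 6 * c\<^sup>2 + T p u u"
    using u(2) T_commute(3)[of p u p] by (simp add: vc tri_add tri_scaleR T_ppp power2_eq_square)
  have "T p v v - T p p v * T p p v / 4 = - (3 * c\<^sup>2 - T p u u)"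
    unfolding 1 2 by (simp add: power2_eq_square)
  then have "v \<bullet> (Bm *v v) = (3 * c\<^sup>2 - T p u u) / (4 * r\<^sup>2)"
    by (simp add: Bm_bilinear del: minus_diff_eq)
  moreover have "0 < 3 * c\<^sup>2 - T p u u"
  proof (cases "u = 0")
    case True
    then have "c \<noteq> 0" using v vc by auto
    then show ?thesis using True by simp
  next
    case False
    then show ?thesis using T_neg[OF u(2)] by (smt (verit) zero_le_power2)
  qed
  ultimately show ?thesis using r by simp
qed

lemma det_Bm: "det Bm = (1 / (4 * r\<^sup>2)) ^ CARD('n) * \<bar>det A\<bar> / 2"
proof -
  let ?M = "\<chi> a b. A $ a $ b + (A *v p) $ a * (- (1/4) *\<^sub>R (A *v p)) $ b"
  have "Bm = (\<chi> a b. - (1 / (4 * r\<^sup>2)) * ?M $ a $ b)"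
    by (simp add: vec_eq_iff Bm_entry)
  then have "det Bm = (- (1 / (4 * r\<^sup>2))) ^ CARD('n) * det ?M"
    by (simp only: det_scale_entries)
  also have "det ?M = det A * (1 + p \<bullet> (- (1/4) *\<^sub>R (A *v p)))"
    by (rule det_add_rank_one) simp
  also have "\<dots> = - det A / 2" by (simp add: A_bilinear T_ppp)
  finally have "det Bm = (- (1 / (4 * r\<^sup>2))) ^ CARD('n) * (- det A / 2)" .
  then have "\<bar>det Bm\<bar> = (1 / (4 * r\<^sup>2)) ^ CARD('n) * \<bar>det A\<bar> / 2"
    by (simp add: abs_mult power_abs)
  moreover have "0 < det Bm" by (rule det_pos_if_pos_definite) (rule Bm_pos)
  ultimately show ?thesis by simp
qed

section \<open>The tangent space of the fiber and the coordinate differentials\<close>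

text \<open>The pairing of \<open>w\<close> with the direction given by a tangent \<open>v\<close>
  is a nonzero multiple of \<open>T p v u\<close>, with \<open>u\<close> the imaginary part of
  \<open>w\<close>, as the rank one term vanishes on \<open>v\<close>. Taking for \<open>v\<close>
  the tangent part of \<open>u\<close> forces that part to be zero.\<close>

lemma fiber_directions_x: "fiber_directions k H x = {w. \<exists>c. im_part (fst w) = c *\<^sub>R p}"
proof -
  have metric: "qmap_metric k x (\<chi> a. Complex 0 (r * v $ a), 0, 0, 0, 0) w = r * (v \<bullet> (Bm *v im_part (fst w)))" for v w
  proof -
    have re: "re_part (\<chi> a. Complex 0 (r * v $ a)) = 0" and im: "im_part (\<chi> a. Complex 0 (r * v $ a)) = r *\<^sub>R v"
      by (simp_all add: re_part_def im_part_def vec_eq_iff)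
    have W: "W_form k z i (\<chi> a. Complex 0 (r * v $ a), 0, 0, 0, 0) = 0" for i
      by (simp add: W_form_def)
    have "qmap_metric k x (\<chi> a. Complex 0 (r * v $ a), 0, 0, 0, 0) w
        = base_metric k z (\<chi> a. Complex 0 (r * v $ a)) (fst w)"
      by (simp add: qmap_metric_def W Let_def)
    also have "\<dots> = r * (v \<bullet> (Bm *v im_part (fst w)))"
      by (simp add: base_metric_def re im inner_vec_def matrix_vector_mult_def Bm_def sum_distrib_left sum_negf mult_ac)
    finally show ?thesis .
  qed
  have "(\<forall>v. T p p v = 0 \<longrightarrow> T p v u = 0) \<longleftrightarrow> (\<exists>c. u = c *\<^sub>R p)" for u
  proof
    assume *: "\<forall>v. T p p v = 0 \<longrightarrow> T p v u = 0"
    obtain u' where u': "u = (T p p u / 6) *\<^sub>R p + u'" "T p p u' = 0" by (rule T_decompose)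
    have "T p u' u = (T p p u / 6) * T p u' p + T p u' u'"
      by (subst u'(1)) (simp only: tri_add tri_scaleR)
    then have "T p u' u' = 0" using * u'(2) T_commute(3)[of p u' p] by simp
    then have "u' = 0" using T_neg[OF u'(2)] by force
    then show "\<exists>c. u = c *\<^sub>R p" using u'(1) by auto
  next
    assume "\<exists>c. u = c *\<^sub>R p"
    then show "\<forall>v. T p p v = 0 \<longrightarrow> T p v u = 0" by (auto simp: tri_scaleR T_commute(3)[of p _ p])
  qed
  moreover have "w \<in> fiber_directions k H x \<longleftrightarrow> (\<forall>v. T p p v = 0 \<longrightarrow> T p v (im_part (fst w)) = 0)" for w
  proof -
    have "psr_directions k H x = (\<lambda>v. (\<chi> a. Complex 0 (r * v $ a), 0, 0, 0, 0)) ` {v. T p p v = 0}"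
      by (auto simp: psr_directions_def radius_x psr_proj_x tangent_space_p)
    then show ?thesis
      using r by (auto simp: fiber_directions_def metric Bm_bilinear)
  qed
  ultimately show ?thesis by auto
qed

text \<open>The differentials of the fiber coordinates at \<open>x\<close>, as
  \<open>frechet_fiber_coord\<close> shows. The entry at \<open>R_idx\<close> is \<open>dr\<close>;
  it equals \<open>c\<close> when \<open>dt = c p\<close>.\<close>

definition coord :: "'n qpoint \<Rightarrow> real ^ 'n fiber_index" where
  "coord w = (case w of (dz, d\<rho>, d\<zeta>t, d\<zeta>, d\<sigma>) \<Rightarrow> \<chi> i. case i of
     R_idx \<Rightarrow> T p p (im_part dz) / 6 | Rho_idx \<Rightarrow> d\<rho> | B_idx a \<Rightarrow> re_part dz $ a
   | Zetat_idx l \<Rightarrow> d\<zeta>t $ l | Zeta_idx l \<Rightarrow> d\<zeta> $ l | Sigma_idx \<Rightarrow> d\<sigma>)"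

lemma frechet_fiber_coord: "frechet_derivative (fiber_coord k i) (at x) w = coord w $ i"
proof -
  have nth: "((\<lambda>y. f y $ a) has_derivative (\<lambda>w. f' w $ a)) (at x)"
    if "(f has_derivative f') (at x)" for f f' and a :: "'m::finite"
    using that by (rule bounded_linear.has_derivative[OF bounded_linear_vec_nth])
  have "(fiber_coord k i has_derivative (\<lambda>w. coord w $ i)) (at x)"
  proof (cases i)
    case R_idx
    have im: "linear (im_part :: complex ^ 'n \<Rightarrow> _)"
      by (rule linearI) (simp_all add: im_part_def vec_eq_iff)
    have "((\<lambda>y. im_part (fst y)) has_derivative (\<lambda>w. im_part (fst w))) (at x)"
      by (rule linear_imp_has_derivative) (auto intro: linear_compose[OF linear_fst im, unfolded o_def])
    from has_derivative_compose[OF this, of "cubic k" "\<lambda>v. T v (im_part z) (im_part z) / 2"]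
    have 1: "((\<lambda>y. cubic k (im_part (fst y))) has_derivative (\<lambda>w. T (im_part (fst w)) (im_part z) (im_part z) / 2)) (at x)"
      using has_derivative_cubic[OF sym] by simp
    have 2: "(root 3 has_real_derivative inverse (real 3 * root 3 (r ^ 3) ^ (3 - Suc 0))) (at (cubic k (im_part (fst x))))"
      unfolding fst_conv cubic_t by (rule DERIV_real_root) (use r in auto)
    have "((\<lambda>y. root 3 (cubic k (im_part (fst y)))) has_derivative
        (\<lambda>w. inverse (real 3 * root 3 (r ^ 3) ^ (3 - Suc 0)) * (T (im_part (fst w)) (im_part z) (im_part z) / 2))) (at x)"
      by (rule has_derivative_compose[OF 1 2[unfolded has_field_derivative_def]])
    \<comment> \<open>The cube root contributes \<open>1 / (3 r^2)\<close>, and the cubic at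
      \<open>r p\<close> contributes \<open>r^2 / 2\<close> times \<open>T p p\<close> of the
      imaginary part.\<close>
    moreover have "inverse (real 3 * root 3 (r ^ 3) ^ (3 - Suc 0)) * (T (im_part (fst w)) (im_part z) (im_part z) / 2) = coord w $ i" for w
      using r by (simp add: R_idx coord_def t tri_scaleR real_root_power_cancel T_commute field_simps power2_eq_square split: prod.splits)
    ultimately show ?thesis
      by (simp add: R_idx fiber_coord_def[abs_def] radius_def case_prod_unfold)
  next
    case (B_idx a)
    have "linear (\<lambda>w :: 'n qpoint. re_part (fst w) $ a)"
      by (rule linearI) (simp_all add: re_part_def)
    then show ?thesis
      by (simp add: B_idx fiber_coord_def[abs_def] coord_def case_prod_unfold linear_imp_has_derivative)
  qed (auto simp: fiber_coord_def[abs_def] coord_def case_prod_unfold intro!: derivative_eq_intros nth)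
  then show ?thesis by (simp add: frechet_derivative_at[symmetric])
qed

text \<open>The transition matrix from the coordinate differentials to the coframe, with
  \<open>Re W\<close> stored at the indices \<open>Zetat_idx\<close> and \<open>Im W\<close> at the
  indices \<open>Zeta_idx\<close>.\<close>

definition coframe :: "real ^ 'n fiber_index ^ 'n fiber_index" where
  "coframe = (\<chi> i j. case i of
     R_idx \<Rightarrow> of_bool (j = R_idx) | Rho_idx \<Rightarrow> of_bool (j = Rho_idx) | B_idx a \<Rightarrow> of_bool (j = B_idx a)
   | Zetat_idx l \<Rightarrow> (case j of Zetat_idx m \<Rightarrow> of_bool (l = m) | Zeta_idx m \<Rightarrow> - Re (tau_mat k z $ l $ m) | _ \<Rightarrow> 0)
   | Zeta_idx l \<Rightarrow> (case j of Zeta_idx m \<Rightarrow> - Im (tau_mat k z $ l $ m) | _ \<Rightarrow> 0)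
   | Sigma_idx \<Rightarrow> (case j of Sigma_idx \<Rightarrow> 1 | Zeta_idx m \<Rightarrow> \<zeta>t $ m | Zetat_idx m \<Rightarrow> - \<zeta> $ m | _ \<Rightarrow> 0))"

lemma coframe_coord:
  "(coframe *v coord w) $ R_idx = coord w $ R_idx"
  "(coframe *v coord w) $ Rho_idx = coord w $ Rho_idx"
  "(coframe *v coord w) $ B_idx a = coord w $ B_idx a"
  "(coframe *v coord w) $ Zetat_idx l = Re (W_form k z l w)"
  "(coframe *v coord w) $ Zeta_idx l = Im (W_form k z l w)"
  "(coframe *v coord w) $ Sigma_idx = (case w of (dz, d\<rho>, d\<zeta>t, d\<zeta>, d\<sigma>) \<Rightarrow>
      d\<sigma> + (\<Sum>i\<in>UNIV. \<zeta>t $ i * d\<zeta> $ i - \<zeta> $ i * d\<zeta>t $ i))"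
  by (cases w; simp add: matrix_vector_mult_def coframe_def sum_fiber_index W_form_def coord_def
      Re_sum Im_sum sum_negf sum_subtractf of_bool_def if_distrib[of "\<lambda>x. x * _"] cong: if_cong)+

section \<open>The form \<open>N\<close> on the vector \<open>(1, z)\<close>, and its
  invertibility\<close>

abbreviation "N \<equiv> N_mat k z"
abbreviation "ext_re \<equiv> re_part (extend z)"
abbreviation "ext_im \<equiv> im_part (extend z)"

lemma shear_ext: "shear (re_part z) ext_re = 0" "shear (re_part z) ext_im = im_part z"
  "ext_re $ None = 1" "ext_im $ None = 0"
  by (simp_all add: shear_def vec_eq_iff re_part_def im_part_def extend_def)

text \<open>In the sheared variables the real and imaginary parts of \<open>(1, z)\<close> are
  \<open>(1, 0)\<close> and \<open>(0, t)\<close>, hence orthogonal for \<open>N\<close>. The two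
  values add up to \<open>8 r^3\<close>, which is \<open>K\<close>.\<close>

lemma N_ext:
  "ext_re \<bullet> (N *v ext_re) = - 4 * r ^ 3" "ext_im \<bullet> (N *v ext_im) = 12 * r ^ 3"
  "ext_re \<bullet> (N *v ext_im) = 0" "ext_im \<bullet> (N *v ext_re) = 0"
  by (simp_all add: N_mat_bilinear[OF sym] shear_ext cubic_t)
     (simp add: t tri_scaleR T_ppp power3_eq_cube)

text \<open>For \<open>y\<close> in the kernel, pairing with \<open>ext_re\<close> gives
  \<open>y $ None = 0\<close>. Vectors with vanishing component at \<open>None\<close> have
  arbitrary shear, so nondegeneracy of \<open>T p\<close> then kills the shear of
  \<open>y\<close>.\<close>

lemma N_invertible: "invertible N"
proof -
  have "y = 0" if y: "N *v y = 0" for y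
  proof -
    have B: "2 * T (im_part z) (shear (re_part z) v) (shear (re_part z) y) = 4 * r ^ 3 * v $ None * y $ None" for v
      using N_mat_bilinear[OF sym, of v z y] by (simp add: y cubic_t)
    have y0: "y $ None = 0" using B[of ext_re] r by (simp add: shear_ext)
    have "T p w (shear (re_part z) y) = 0" for w
    proof -
      define v where "v = (\<chi> i. case i of None \<Rightarrow> 0 | Some a \<Rightarrow> w $ a)"
      have "shear (re_part z) v = w" "v $ None = 0" by (simp_all add: shear_def v_def vec_eq_iff)
      then show ?thesis using B[of v] r by (simp add: t tri_scaleR)
    qed
    then have "shear (re_part z) y = 0" by (rule T_nondegenerate)
    then have "y $ Some a = 0" for a using y0 by (simp add: shear_def vec_eq_iff)
    then show ?thesis using y0 by (simp add: vec_eq_iff split_option_all)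
  qed
  then show ?thesis
    by (simp add: invertible_left_inverse matrix_left_invertible_ker)
qed

lemma N_inv: "N ** matrix_inv N = mat 1" "matrix_inv N ** N = mat 1"
  using N_invertible by (simp_all add: matrix_mul_matrix_inv)

section \<open>The metric in the coframe and its determinant\<close>

text \<open>The metric in the coframe without the rank one terms of the \<open>W\<close>-part. The
  entry at \<open>R_idx\<close> is \<open>p \<bullet> (Bm *v p)\<close>.\<close>

definition block_form :: "real ^ 'n fiber_index ^ 'n fiber_index" where
  "block_form = (\<chi> i j. case (i, j) of
     (R_idx, R_idx) \<Rightarrow> 3 / (4 * r\<^sup>2) | (Rho_idx, Rho_idx) \<Rightarrow> 1 / (4 * \<rho>\<^sup>2) | (Sigma_idx, Sigma_idx) \<Rightarrow> 1 / (64 * \<rho>\<^sup>2)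
   | (B_idx a, B_idx b) \<Rightarrow> Bm $ a $ b
   | (Zetat_idx l, Zetat_idx m) \<Rightarrow> - 1 / (4 * \<rho>) * matrix_inv N $ l $ m
   | (Zeta_idx l, Zeta_idx m) \<Rightarrow> - 1 / (4 * \<rho>) * matrix_inv N $ l $ m
   | _ \<Rightarrow> 0)"

definition zeta_vec :: "real ^ 'n option \<Rightarrow> real ^ 'n option \<Rightarrow> real ^ 'n fiber_index" where
  "zeta_vec u v = (\<chi> i. case i of Zetat_idx l \<Rightarrow> u $ l | Zeta_idx l \<Rightarrow> v $ l | _ \<Rightarrow> 0)"

text \<open>The factor is \<open>-1 / (4 \<rho>)\<close> times \<open>-2 / K\<close> with \<open>K = 8 r\<^sup>3\<close>; the two vectors represent the real and
  imaginary parts of \<open>z\<^sup>i W\<^sub>i\<close>.\<close>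

definition metric_mat :: "real ^ 'n fiber_index ^ 'n fiber_index" where
  "metric_mat = (\<chi> i j. block_form $ i $ j + 1 / (16 * \<rho> * r ^ 3) *
     (zeta_vec ext_re (- ext_im) $ i * zeta_vec ext_re (- ext_im) $ j
      + zeta_vec ext_im ext_re $ i * zeta_vec ext_im ext_re $ j))"

lemma zeta_vec_inner: "zeta_vec u v \<bullet> y = (\<Sum>l\<in>UNIV. u $ l * y $ Zetat_idx l) + (\<Sum>l\<in>UNIV. v $ l * y $ Zeta_idx l)"
  by (simp add: inner_vec_def sum_fiber_index zeta_vec_def)

lemma block_form_mult:
  "(block_form *v \<psi>) $ R_idx = 3 / (4 * r\<^sup>2) * \<psi> $ R_idx"
  "(block_form *v \<psi>) $ Rho_idx = 1 / (4 * \<rho>\<^sup>2) * \<psi> $ Rho_idx"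
  "(block_form *v \<psi>) $ Sigma_idx = 1 / (64 * \<rho>\<^sup>2) * \<psi> $ Sigma_idx"
  "(block_form *v \<psi>) $ B_idx a = (\<Sum>b\<in>UNIV. Bm $ a $ b * \<psi> $ B_idx b)"
  "(block_form *v \<psi>) $ Zetat_idx l = - 1 / (4 * \<rho>) * (\<Sum>m\<in>UNIV. matrix_inv N $ l $ m * \<psi> $ Zetat_idx m)"
  "(block_form *v \<psi>) $ Zeta_idx l = - 1 / (4 * \<rho>) * (\<Sum>m\<in>UNIV. matrix_inv N $ l $ m * \<psi> $ Zeta_idx m)"
  by (simp_all add: matrix_vector_mult_def sum_fiber_index block_form_def sum_distrib_left sum_negf)

lemma block_form_bilinear:
  "\<phi> \<bullet> (block_form *v \<psi>) = 3 / (4 * r\<^sup>2) * \<phi> $ R_idx * \<psi> $ R_idx + \<phi> $ Rho_idx * \<psi> $ Rho_idx / (4 * \<rho>\<^sup>2)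
    + \<phi> $ Sigma_idx * \<psi> $ Sigma_idx / (64 * \<rho>\<^sup>2)
    + (\<Sum>a\<in>UNIV. \<Sum>b\<in>UNIV. Bm $ a $ b * \<phi> $ B_idx a * \<psi> $ B_idx b)
    - 1 / (4 * \<rho>) * (\<Sum>l\<in>UNIV. \<Sum>m\<in>UNIV. matrix_inv N $ l $ m *
        (\<phi> $ Zetat_idx l * \<psi> $ Zetat_idx m + \<phi> $ Zeta_idx l * \<psi> $ Zeta_idx m))"
proof -
  have E: "(\<Sum>l\<in>UNIV. f l * (c * (\<Sum>m\<in>UNIV. A l m * g m))) = c * (\<Sum>l\<in>UNIV. \<Sum>m\<in>UNIV. A l m * (f l * g m))"
    for f g :: "'n option \<Rightarrow> real" and A c
    by (simp add: sum_distrib_left mult_ac)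
  show ?thesis
    unfolding inner_vec_def sum_fiber_index block_form_mult inner_real_def E
    by (simp add: sum_distrib_left distrib_left sum.distrib sum_negf mult_ac)
qed

text \<open>On fiber vectors \<open>dt = dr p\<close>, so the \<open>dt\<close>-part of the base
  metric collapses to a multiple of \<open>dr^2\<close>. The \<open>W\<close>-part is split by
  \<open>Re_rank_one_hermitian_form\<close>.\<close>

lemma qmap_metric_fiber:
  assumes v: "im_part (fst v) = c *\<^sub>R p" and w: "im_part (fst w) = d *\<^sub>R p"
  shows "qmap_metric k x v w = (coframe *v coord v) \<bullet> (metric_mat *v (coframe *v coord w))"
proof -
  define \<phi> \<psi> where "\<phi> = coframe *v coord v" and "\<psi> = coframe *v coord w"
  obtain dz d\<rho> d\<zeta>t d\<zeta> d\<sigma> where v': "v = (dz, d\<rho>, d\<zeta>t, d\<zeta>, d\<sigma>)" by (cases v)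
  obtain dz' d\<rho>' d\<zeta>t' d\<zeta>' d\<sigma>' where w': "w = (dz', d\<rho>', d\<zeta>t', d\<zeta>', d\<sigma>')" by (cases w)
  have \<phi>: "\<phi> $ R_idx = c" "\<phi> $ Rho_idx = d\<rho>" "\<phi> $ B_idx a = re_part dz $ a" 
    "\<phi> $ Zetat_idx l = Re (W_form k z l v)" "\<phi> $ Zeta_idx l = Im (W_form k z l v)"
    "\<phi> $ Sigma_idx = d\<sigma> + (\<Sum>i\<in>UNIV. \<zeta>t $ i * d\<zeta> $ i - \<zeta> $ i * d\<zeta>t $ i)" for a l
    using v by (simp_all only: \<phi>_def coframe_coord) (simp_all add: v' coord_def tri_scaleR T_ppp)
  have \<psi>: "\<psi> $ R_idx = d" "\<psi> $ Rho_idx = d\<rho>'" "\<psi> $ B_idx a = re_part dz' $ a" 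
    "\<psi> $ Zetat_idx l = Re (W_form k z l w)" "\<psi> $ Zeta_idx l = Im (W_form k z l w)"
    "\<psi> $ Sigma_idx = d\<sigma>' + (\<Sum>i\<in>UNIV. \<zeta>t $ i * d\<zeta>' $ i - \<zeta> $ i * d\<zeta>t' $ i)" for a l
    using w by (simp_all only: \<psi>_def coframe_coord) (simp_all add: w' coord_def tri_scaleR T_ppp)
  have "base_metric k z dz dz' = (\<Sum>a\<in>UNIV. \<Sum>b\<in>UNIV. Bm $ a $ b * (re_part dz $ a * re_part dz' $ b + im_part dz $ a * im_part dz' $ b))"
    by (simp add: base_metric_def Bm_def sum_distrib_left sum_negf mult_ac)
  also have "\<dots> = (\<Sum>a\<in>UNIV. \<Sum>b\<in>UNIV. Bm $ a $ b * re_part dz $ a * re_part dz' $ b) + im_part dz \<bullet> (Bm *v im_part dz')"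
    by (simp add: distrib_left sum.distrib inner_vec_def matrix_vector_mult_def sum_distrib_left mult_ac)
  also have "im_part dz \<bullet> (Bm *v im_part dz') = 3 / (4 * r\<^sup>2) * c * d"
    using v w by (simp add: v' w' Bm_bilinear tri_scaleR T_ppp)
  finally have base: "base_metric k z dz dz' = (\<Sum>a\<in>UNIV. \<Sum>b\<in>UNIV. Bm $ a $ b * re_part dz $ a * re_part dz' $ b) + 3 / (4 * r\<^sup>2) * c * d" .
  have a: "zeta_vec ext_re (- ext_im) \<bullet> \<phi> = Re (\<Sum>i\<in>UNIV. extend z $ i * W_form k z i v)"
    "zeta_vec ext_im ext_re \<bullet> \<phi> = Im (\<Sum>i\<in>UNIV. extend z $ i * W_form k z i v)"
    "zeta_vec ext_re (- ext_im) \<bullet> \<psi> = Re (\<Sum>i\<in>UNIV. extend z $ i * W_form k z i w)"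
    "zeta_vec ext_im ext_re \<bullet> \<psi> = Im (\<Sum>i\<in>UNIV. extend z $ i * W_form k z i w)"
    by (simp_all add: zeta_vec_inner \<phi> \<psi> Re_sum Im_sum sum_subtractf sum.distrib sum_negf re_part_def im_part_def)
  have "metric_mat *v \<psi> = block_form *v \<psi> + (1 / (16 * \<rho> * r ^ 3)) *\<^sub>R
      ((zeta_vec ext_re (- ext_im) \<bullet> \<psi>) *\<^sub>R zeta_vec ext_re (- ext_im) + (zeta_vec ext_im ext_re \<bullet> \<psi>) *\<^sub>R zeta_vec ext_im ext_re)"
    by (simp add: metric_mat_def vec_eq_iff matrix_vector_mult_def inner_vec_def algebra_simps sum.distrib sum_distrib_left sum_divide_distrib)
  then have mm: "\<phi> \<bullet> (metric_mat *v \<psi>) = \<phi> \<bullet> (block_form *v \<psi>) + 1 / (16 * \<rho> * r ^ 3) *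
      ((zeta_vec ext_re (- ext_im) \<bullet> \<phi>) * (zeta_vec ext_re (- ext_im) \<bullet> \<psi>)
        + (zeta_vec ext_im ext_re \<bullet> \<phi>) * (zeta_vec ext_im ext_re \<bullet> \<psi>))"
    by (simp only: inner_add_right inner_scaleR_right) (simp add: inner_commute[of \<phi>] mult_ac)
  have K: "1 / (4 * \<rho>) * (2 / (8 * r ^ 3)) = 1 / (16 * \<rho> * r ^ 3)" by simp
  have "qmap_metric k x v w = base_metric k z dz dz' + d\<rho> * d\<rho>' / (4 * \<rho>\<^sup>2)
        - 1 / (4 * \<rho>) * Re (\<Sum>i\<in>UNIV. \<Sum>j\<in>UNIV.
            (of_real (matrix_inv N $ i $ j) - of_real (2 / (8 * r ^ 3)) * extend z $ i * cnj (extend z $ j))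
            * W_form k z i v * cnj (W_form k z j w))
        + \<phi> $ Sigma_idx * \<psi> $ Sigma_idx / (64 * \<rho>\<^sup>2)"
    by (simp only: qmap_metric_def Let_def v' w' \<phi>(6) \<psi>(6) prod.case fst_conv cubic_t)
  also have "\<dots> = \<phi> \<bullet> (metric_mat *v \<psi>)"
    unfolding mm a block_form_bilinear Re_rank_one_hermitian_form base K[symmetric]
    by (simp add: \<phi> \<psi> algebra_simps)
  finally show ?thesis by (simp add: \<phi>_def \<psi>_def)
qed

lemma det_coframe: "det coframe = (1/2) ^ (CARD('n) + 1) * det N"
proof -
  have blocks: "(\<chi> l m. coframe $ Zetat_idx l $ Zetat_idx m) = mat 1" "(\<chi> a b. coframe $ B_idx a $ B_idx b) = mat 1"
    "(\<chi> l m. coframe $ Zeta_idx l $ Zeta_idx m) = (\<chi> l m. (1/2) * N $ l $ m)"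
    by (auto simp: coframe_def mat_def N_mat_def vec_eq_iff)
  have "det coframe = coframe $ Sigma_idx $ Sigma_idx * (det (mat 1 :: real ^ 'n option ^ 'n option)
      * (det (\<chi> l m. (1/2) * N $ l $ m) * (det (mat 1 :: real ^ 'n ^ 'n)
      * (coframe $ R_idx $ R_idx * coframe $ Rho_idx $ Rho_idx))))"
    unfolding blocks[symmetric]
    by (rule det_block_triangular_fiber_index) (auto simp: coframe_def split: fiber_index.splits)
  then show ?thesis by (simp only: det_scale_entries) (simp add: coframe_def)
qed

lemma det_metric_mat: "det metric_mat = 3 / (1024 * \<rho> ^ 4 * r\<^sup>2) * (1 / (16 * \<rho>\<^sup>2)) ^ (CARD('n) + 1) * det (matrix_inv N) ^ 2 * det Bm"
proof -
  have "(\<Sum>m\<in>UNIV. matrix_inv N $ l $ m * ((- 4 * \<rho>) *\<^sub>R (N *v u)) $ m) = - 4 * \<rho> * u $ l" for l u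
  proof -
    have "(\<Sum>m\<in>UNIV. matrix_inv N $ l $ m * ((- 4 * \<rho>) *\<^sub>R (N *v u)) $ m)
        = (matrix_inv N *v ((- 4 * \<rho>) *\<^sub>R (N *v u))) $ l"
      by (simp only: matrix_vector_mult_def vec_lambda_beta)
    also have "\<dots> = - 4 * \<rho> * u $ l"
      by (simp only: matrix_vector_mult_scaleR matrix_vector_mul_assoc N_inv) simp
    finally show ?thesis .
  qed
  note inv = this
  \<comment> \<open>Since the \<open>W\<close>-blocks are \<open>-1 / (4 \<rho>)\<close> times the
    inverse of \<open>N\<close>, applying \<open>-4 \<rho> N\<close> supplies the preimages required
    by \<open>det_add_two_rank_one\<close>.\<close>
  have block: "block_form *v zeta_vec ((- 4 * \<rho>) *\<^sub>R (N *v u)) ((- 4 * \<rho>) *\<^sub>R (N *v v)) = zeta_vec u v" for u v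
  proof (rule vec_eq_iff[THEN iffD2, rule_format])
    fix i
    have z: "zeta_vec u v $ Zetat_idx l = u $ l" "zeta_vec u v $ Zeta_idx l = v $ l" for u v l
      by (simp_all add: zeta_vec_def)
    show "(block_form *v zeta_vec ((- 4 * \<rho>) *\<^sub>R (N *v u)) ((- 4 * \<rho>) *\<^sub>R (N *v v))) $ i = zeta_vec u v $ i"
    proof (cases i)
      case (Zetat_idx l)
      show ?thesis unfolding Zetat_idx block_form_mult z inv using \<rho> by simp
    next
      case (Zeta_idx l)
      show ?thesis unfolding Zeta_idx block_form_mult z inv using \<rho> by simp
    qed (simp_all only: block_form_mult, simp_all add: zeta_vec_def)
  qed
  have zz: "zeta_vec u v \<bullet> zeta_vec u' v' = u \<bullet> u' + v \<bullet> v'" for u v u' v'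
    by (simp add: zeta_vec_inner) (simp add: inner_vec_def zeta_vec_def)
  have "det metric_mat = det block_form
     * (1 + 1 / (16 * \<rho> * r ^ 3) * (zeta_vec ext_re (- ext_im) \<bullet> zeta_vec ((- 4 * \<rho>) *\<^sub>R (N *v ext_re)) ((- 4 * \<rho>) *\<^sub>R (N *v - ext_im))))
     * (1 + 1 / (16 * \<rho> * r ^ 3) * (zeta_vec ext_im ext_re \<bullet> zeta_vec ((- 4 * \<rho>) *\<^sub>R (N *v ext_im)) ((- 4 * \<rho>) *\<^sub>R (N *v ext_re))))"
    unfolding metric_mat_def
    by (rule det_add_two_rank_one, rule block, rule block) (simp add: zz N_ext)
  \<comment> \<open>Both inner products equal \<open>-4 \<rho>\<close> times \<open>8 r^3\<close>,
    so each factor is \<open>1 - 2\<close> and the product is 1.\<close>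
  also have "\<dots> = det block_form"
  proof -
    have "N *v - u = - (N *v u)" for u by (simp add: matrix_vector_mult_def vec_eq_iff sum_negf)
    then show ?thesis using r \<rho> by (simp add: zz N_ext)
  qed
  also have "\<dots> = 1 / (64 * \<rho>\<^sup>2) * (det (\<chi> l m. - 1 / (4 * \<rho>) * matrix_inv N $ l $ m)
      * (det (\<chi> l m. - 1 / (4 * \<rho>) * matrix_inv N $ l $ m) * (det Bm * (3 / (4 * r\<^sup>2) * (1 / (4 * \<rho>\<^sup>2))))))"
    by (subst det_block_triangular_fiber_index) (auto simp: block_form_def split: fiber_index.splits)
  also have "\<dots> = 1 / (64 * \<rho>\<^sup>2) * 3 / (4 * r\<^sup>2) * (1 / (4 * \<rho>\<^sup>2)) * ((- 1 / (4 * \<rho>)) ^ (CARD('n) + 1) * (- 1 / (4 * \<rho>)) ^ (CARD('n) + 1)) * det (matrix_inv N) ^ 2 * det Bm"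
    by (simp only: det_scale_entries) (simp add: power2_eq_square mult_ac)
  also have "(- 1 / (4 * \<rho>)) ^ (CARD('n) + 1) * (- 1 / (4 * \<rho>)) ^ (CARD('n) + 1) = (1 / (16 * \<rho>\<^sup>2)) ^ (CARD('n) + 1)"
    unfolding power_mult_distrib[symmetric] by (simp add: power2_eq_square)
  also have "1 / (64 * \<rho>\<^sup>2) * 3 / (4 * r\<^sup>2) * (1 / (4 * \<rho>\<^sup>2)) = 3 / (1024 * \<rho> ^ 4 * r\<^sup>2)"
    by (simp add: power2_eq_square power4_eq_xxxx)
  finally show ?thesis .
qed

text \<open>The squared determinants of \<open>N\<close> and of its inverse cancel. With
  \<open>n = CARD('n)\<close>, the exponents in the denominator are \<open>4 + 2 (n + 1)\<close> for
  \<open>\<rho>\<close> and \<open>2 + 2 n\<close> for \<open>r\<close>, both even, so the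
  denominator is a square.\<close>

lemma det_total:
  "det metric_mat * (det coframe)\<^sup>2 = 3 / 2048 * (1 / 64) ^ (CARD('n) + 1) * (1 / 4) ^ CARD('n) * \<bar>det A\<bar> / (\<rho> ^ (CARD('n) + 3) * r ^ (CARD('n) + 1))\<^sup>2"
proof -
  let ?n = "CARD('n)"
  have "det (matrix_inv N) * det N = 1"
    by (simp add: det_mul[symmetric] N_inv)
  then have "(det (matrix_inv N))\<^sup>2 * (det N)\<^sup>2 = 1"
    by (simp add: power_mult_distrib[symmetric])
  then have "det metric_mat * (det coframe)\<^sup>2 =
     3 / (1024 * \<rho> ^ 4 * r\<^sup>2) * (1 / (16 * \<rho>\<^sup>2)) ^ (?n + 1) * ((1 / (4 * r\<^sup>2)) ^ ?n * \<bar>det A\<bar> / 2) * ((1/2) ^ (?n + 1))\<^sup>2"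
    unfolding det_metric_mat det_coframe det_Bm power_mult_distrib[of _ "det N" 2]
    by (simp add: mult_ac)
  also have "\<dots> = 3 / 2048 * ((1 / 16) ^ (?n + 1) * (1 / 4) ^ (?n + 1)) * (1 / 4) ^ ?n * \<bar>det A\<bar> / (\<rho> ^ 4 * r\<^sup>2 * (\<rho>\<^sup>2) ^ (?n + 1) * (r\<^sup>2) ^ ?n)"
  proof -
    have "((1/2) ^ (?n + 1))\<^sup>2 = (1 / 4 :: real) ^ (?n + 1)"
      by (subst power_mult[symmetric], subst mult.commute, subst power_mult) (simp add: power2_eq_square)
    moreover have "(1 / (16 * \<rho>\<^sup>2)) ^ (?n + 1) = (1 / 16) ^ (?n + 1) / (\<rho>\<^sup>2) ^ (?n + 1)"
      by (simp add: power_divide power_mult_distrib)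
    moreover have "(1 / (4 * r\<^sup>2)) ^ ?n = (1 / 4) ^ ?n / (r\<^sup>2) ^ ?n"
      by (simp add: power_divide power_mult_distrib)
    moreover have "3 / (1024 * a * b) * (x / c) * (y / d * e / 2) * w = 3 / 2048 * (x * w) * y * e / (a * b * c * d)"
      for a b c d e w x y :: real by (simp add: mult_ac)
    ultimately show ?thesis by (simp only:)
  qed
  also have "\<rho> ^ 4 * r\<^sup>2 * (\<rho>\<^sup>2) ^ (?n + 1) * (r\<^sup>2) ^ ?n = (\<rho> ^ (?n + 3) * r ^ (?n + 1))\<^sup>2"
    by (simp add: power_mult_distrib power_add power2_eq_square power4_eq_xxxx power3_eq_cube mult_ac flip: power_mult)
  also have "(1 / 16) ^ (?n + 1) * (1 / 4) ^ (?n + 1) = (1 / 64 :: real) ^ (?n + 1)"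
    unfolding power_mult_distrib[symmetric] by simp
  finally show ?thesis .
qed

section \<open>Gram determinants and the density\<close>

text \<open>The Gram matrix is the congruence of \<open>metric_mat\<close> by \<open>F\<close>, the
  matrix of coframe components of the tuple. It factors through the coordinate components
  \<open>G\<close>, whose determinant is the value of the coordinate volume form.\<close>

lemma det_qmap_metric:
  assumes e: "range e \<subseteq> fiber_directions k H x"
  shows "det (\<chi> i j. qmap_metric k x (e i) (e j)) = det metric_mat * (det coframe)\<^sup>2 * (dvol_fiber k x e)\<^sup>2"
proof -
  define G where "G = (\<chi> i j. coord (e j) $ i)"
  have dvol: "dvol_fiber k x e = det G"
    by (simp add: dvol_fiber_def G_def frechet_fiber_coord)
  define F where "F = coframe ** G"
  have F: "F $ i $ j = (coframe *v coord (e j)) $ i" for i j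
    by (simp add: F_def G_def matrix_matrix_mult_def matrix_vector_mult_def)
  have "qmap_metric k x (e i) (e j) = (Finite_Cartesian_Product.transpose F ** (metric_mat ** F)) $ i $ j" for i j
  proof -
    obtain c d where "im_part (fst (e i)) = c *\<^sub>R p" "im_part (fst (e j)) = d *\<^sub>R p"
      using e unfolding fiber_directions_x by blast
    then have "qmap_metric k x (e i) (e j) = (coframe *v coord (e i)) \<bullet> (metric_mat *v (coframe *v coord (e j)))"
      by (rule qmap_metric_fiber)
    also have "\<dots> = (Finite_Cartesian_Product.transpose F ** (metric_mat ** F)) $ i $ j"
      by (simp add: inner_vec_def matrix_matrix_mult_def matrix_vector_mult_def[of metric_mat] Finite_Cartesian_Product.transpose_def F)
    finally show ?thesis .
  qed
  then have "(\<chi> i j. qmap_metric k x (e i) (e j)) = Finite_Cartesian_Product.transpose F ** (metric_mat ** F)"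
    by (simp add: vec_eq_iff)
  then show ?thesis
    by (simp add: det_mul dvol F_def power2_eq_square)
qed

text \<open>The basis dual to the coordinate differentials, in which the \<open>r\<close>-direction
  has \<open>dt = p\<close>. Evaluation on it makes the density unique.\<close>

lemma fiber_basis:
  obtains e where "range e \<subseteq> fiber_directions k H x" "dvol_fiber k x e = 1"
proof
  define e :: "'n fiber_index \<Rightarrow> 'n qpoint" where
    "e j = (\<chi> a. Complex (of_bool (j = B_idx a)) (of_bool (j = R_idx) * p $ a), of_bool (j = Rho_idx),
       \<chi> l. of_bool (j = Zetat_idx l), \<chi> l. of_bool (j = Zeta_idx l), of_bool (j = Sigma_idx))" for j
  have im: "im_part (fst (e j)) = of_bool (j = R_idx) *\<^sub>R p" for j
    by (simp add: e_def im_part_def vec_eq_iff)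
  then show "range e \<subseteq> fiber_directions k H x" unfolding fiber_directions_x by blast
  have "coord (e j) $ i = (if i = j then 1 else 0)" for i j
    using im[of j] by (cases i) (auto simp: e_def coord_def re_part_def tri_scaleR T_ppp)
  then have "(\<chi> i j. coord (e j) $ i) = mat 1" by (simp add: mat_def vec_eq_iff)
  then show "dvol_fiber k x e = 1"
    by (simp add: dvol_fiber_def frechet_fiber_coord)
qed

lemma fiber_density_x:
  "fiber_density k H x = sqrt (3 / 2048 * (1 / 64) ^ (CARD('n) + 1) * (1 / 4) ^ CARD('n))
     / (\<rho> ^ (CARD('n) + 3) * r ^ (CARD('n) + 1)) * sqrt \<bar>det A\<bar>" (is "_ = ?d")
  unfolding fiber_density_def
proof (rule the_equality)
  have d: "0 < ?d" using r \<rho> det_A_nz by simp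
  \<comment> \<open>The constant in \<open>?d\<close> is the square root of the numerical factor in
    \<open>det_total\<close>.\<close>
  have d2: "?d\<^sup>2 = det metric_mat * (det coframe)\<^sup>2"
    unfolding det_total by (simp add: power_mult_distrib power_divide)
  show "0 < ?d \<and> (\<forall>e. range e \<subseteq> fiber_directions k H x \<longrightarrow>
      det (\<chi> i j. qmap_metric k x (e i) (e j)) = (?d * dvol_fiber k x e)\<^sup>2)"
    by (intro conjI allI impI d) (simp only: det_qmap_metric power_mult_distrib[of ?d] d2)
  fix d' assume d': "0 < d' \<and> (\<forall>e. range e \<subseteq> fiber_directions k H x \<longrightarrow>
      det (\<chi> i j. qmap_metric k x (e i) (e j)) = (d' * dvol_fiber k x e)\<^sup>2)"
  obtain e where e: "range e \<subseteq> fiber_directions k H x" "dvol_fiber k x e = 1" by (rule fiber_basis)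
  then have "d'\<^sup>2 = ?d\<^sup>2" using d' det_qmap_metric[OF e(1)] unfolding d2 by simp
  then show "d' = ?d" using d d' by (simp add: power2_eq_iff_nonneg)
qed

end

theorem theorem3p26:
  shows "\<exists>C>0. \<forall>(k :: 'n::finite \<Rightarrow> 'n \<Rightarrow> 'n \<Rightarrow> real) H. psr_manifold k H \<longrightarrow>
    (\<forall>z \<rho> \<zeta>t \<zeta> \<sigma>. (z, \<rho>, \<zeta>t, \<zeta>, \<sigma>) \<in> qmap_space H \<longrightarrow>
      (let x = (z, \<rho>, \<zeta>t, \<zeta>, \<sigma>) in
        fiber_density k H x =
          C / (\<rho> ^ (CARD('n) + 3) * radius k x ^ (CARD('n) + 1))
            * sqrt \<bar>det (hessian (cubic k) (psr_proj k x))\<bar>))"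
proof (intro exI[of _ "sqrt (3 / 2048 * (1 / 64) ^ (CARD('n) + 1) * (1 / 4) ^ CARD('n))"] conjI allI impI)
  fix k :: "'n \<Rightarrow> 'n \<Rightarrow> 'n \<Rightarrow> real" and H z \<rho> \<zeta>t \<zeta> \<sigma>
  assume psr: "psr_manifold k H" and "(z, \<rho>, \<zeta>t, \<zeta>, \<sigma>) \<in> qmap_space H"
  then obtain s p where "im_part z = s *\<^sub>R p" "0 < s" "p \<in> H" "0 < \<rho>"
    by (auto simp: qmap_space_def)
  \<comment> \<open>The scaling factor \<open>s\<close> takes the role of \<open>r\<close>, so
    \<open>radius_x\<close> identifies it with the radius.\<close>
  then interpret qmap_point k H z \<rho> \<zeta>t \<zeta> \<sigma> p s
    using psr by unfold_locales auto
  show "let x = (z, \<rho>, \<zeta>t, \<zeta>, \<sigma>) in fiber_density k H x =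
      sqrt (3 / 2048 * (1 / 64) ^ (CARD('n) + 1) * (1 / 4) ^ CARD('n))
        / (\<rho> ^ (CARD('n) + 3) * radius k x ^ (CARD('n) + 1))
        * sqrt \<bar>det (hessian (cubic k) (psr_proj k x))\<bar>"
    unfolding Let_def fiber_density_x radius_x psr_proj_x A_def ..
qed simp

end
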